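(* Let $q$ be a prime power and $m\geq 1$. Let $M(x)=x^{2m}+c_{2m-1}x^{2m-1}+\cdots+c_1x+1\in\mathbb{F}_q[x]$ be a monic self-reciprocal polynomial of degree $2m$ with $M(0)=1$ (so $c_i=c_{2m-i}$ for all $i$, with $c_0=c_{2m}=1$). Suppose that $x-1$ divides $M(x)$ with multiplicity exactly two, and that $M_1(x)=M(x)/(x-1)^2$ has no factor equal to $x\pm 1$ and all its irreducible factors have multiplicity one. Define \[\Phi(x)=x^{q^{2m}}+c_{2m-1}x^{q^{2m-1}}+\cdots+c_1x^q+x\in\mathbb{F}_q[x],\qquad L(x)=\Phi(x)+tx^{q^m}\in\mathbb{F}_q(t)[x],\] and let $G$ be the Galois group of $L(x)$ over $\mathbb{F}_q(t)$, acting on the $2m$-dimensional $\mathbb{F}_q$-space $V$ of roots of $L$. Then there is a prime ideal of degree $1$ in $\mathbb{F}_q[t]$ whose corresponding Frobenius class in $G$ contains an element a power of which acts on $V$ as a symplectic transvection (with respect to a $G$-invariant nondegenerate alternating bilinear form on $V$).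
   Context: A monic polynomial $g\in\mathbb{F}_q[x]$ of degree $d$ with $g(0)\neq0$ is self-reciprocal if $g(x)=x^dg(0)^{-1}g(x^{-1})$. For a $q$-polynomial $L$ over $\mathbb{F}_q(t)$ with nonzero $x$-coefficient, the roots in a splitting field $E$ form an $\mathbb{F}_q$-vector space $V$ of dimension equal to the $q$-degree, and the Galois group $G$ acts $\mathbb{F}_q$-linearly on $V$. Since $\Phi$ (hence $L$) is $q$-palindromic, there is a nondegenerate alternating bilinear form on $V$ invariant under $G$. Frobenius class: for $\mu\in\mathbb{F}_q$, let $I=(t-\mu)\subset\mathbb{F}_q[t]$ (a prime ideal of degree 1), let $R$ be the integral closure of $\mathbb{F}_q[t]$ in $E$, $J$ a prime of $R$ over $I$, and $D\le G$ the decomposition group of $J$. When the reduction of $L$ mod $I$ has nonzero $x$-coefficient, $D$ is cyclic, generated by an element $\sigma$ with $\sigma(z)\equiv z^q \pmod J$ for all $z\in R$; the $G$-conjugacy class of such $\sigma$ (over all choices of $J$) is the Frobenius class of $I$. A symplectic transvection is an element $\sigma$ of the symplectic group with minimal polynomial $(x-1)^2$ such that $\sigma-I$ has rank one. *)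

theory Defs
  imports "HOL-Computational_Algebra.Computational_Algebra" "HOL-Library.Cardinality"
begin

definition self_reciprocal :: "'a::field poly \<Rightarrow> bool" where
  "self_reciprocal g \<longleftrightarrow> lead_coeff g = 1 \<and> coeff g 0 \<noteq> 0 \<and>
     g = smult (inverse (coeff g 0)) (reflect_poly g)"

definition tvar :: "'a::field poly fract" where
  "tvar = Fract [:0, 1:] 1"

definition const_ff :: "'a::field \<Rightarrow> 'a poly fract" where
  "const_ff c = Fract [:c:] 1"

definition Phi_poly :: "'a::{field,finite} poly \<Rightarrow> 'a poly fract poly" where
  "Phi_poly M = (\<Sum>i\<le>degree M. monom (const_ff (coeff M i)) (CARD('a) ^ i))"

definition L_poly :: "nat \<Rightarrow> 'a::{field,finite} poly \<Rightarrow> 'a poly fract poly" where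
  "L_poly m M = Phi_poly M + monom tvar (CARD('a) ^ m)"

definition field_embedding :: "('k::field \<Rightarrow> 'e::field) \<Rightarrow> bool" where
  "field_embedding f \<longleftrightarrow> inj f \<and> f 0 = 0 \<and> f 1 = 1 \<and>
     (\<forall>x y. f (x + y) = f x + f y) \<and> (\<forall>x y. f (x * y) = f x * f y)"

definition is_subfield :: "'e::field set \<Rightarrow> bool" where
  "is_subfield S \<longleftrightarrow> 0 \<in> S \<and> 1 \<in> S \<and> (\<forall>x\<in>S. \<forall>y\<in>S. x + y \<in> S \<and> x * y \<in> S)
     \<and> (\<forall>x\<in>S. - x \<in> S \<and> inverse x \<in> S)"

definition roots_in :: "('k::field \<Rightarrow> 'e::field) \<Rightarrow> 'k poly \<Rightarrow> 'e set" where
  "roots_in emb p = {x. poly (map_poly emb p) x = 0}"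

definition is_splitting_field :: "('k::field \<Rightarrow> 'e::field) \<Rightarrow> 'k poly \<Rightarrow> bool" where
  "is_splitting_field emb p \<longleftrightarrow> field_embedding emb \<and> p \<noteq> 0 \<and>
     (\<exists>c rs. map_poly emb p = smult c (\<Prod>r\<leftarrow>rs. [:- r, 1:])) \<and>
     (\<forall>S. is_subfield S \<and> range emb \<subseteq> S \<and> roots_in emb p \<subseteq> S \<longrightarrow> S = UNIV)"

definition gal_group :: "('k::field \<Rightarrow> 'e::field) \<Rightarrow> ('e \<Rightarrow> 'e) set" where
  "gal_group emb = {\<sigma>. bij \<sigma> \<and> (\<forall>x y. \<sigma> (x + y) = \<sigma> x + \<sigma> y) \<and>
       (\<forall>x y. \<sigma> (x * y) = \<sigma> x * \<sigma> y) \<and> (\<forall>a. \<sigma> (emb a) = emb a)}"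

definition int_closure :: "('a::field poly fract \<Rightarrow> 'e::field) \<Rightarrow> 'e set" where
  "int_closure emb = {z. \<exists>p :: 'a poly poly. lead_coeff p = 1 \<and>
       poly (map_poly (\<lambda>a. emb (Fract a 1)) p) z = 0}"

definition prime_ideal_in :: "'e::field set \<Rightarrow> 'e set \<Rightarrow> bool" where
  "prime_ideal_in R J \<longleftrightarrow> J \<subseteq> R \<and> J \<noteq> R \<and> 0 \<in> J \<and>
     (\<forall>x\<in>J. \<forall>y\<in>J. x + y \<in> J \<and> - x \<in> J) \<and> (\<forall>r\<in>R. \<forall>x\<in>J. r * x \<in> J) \<and>
     (\<forall>x\<in>R. \<forall>y\<in>R. x * y \<in> J \<longrightarrow> x \<in> J \<or> y \<in> J)"

definition lies_over :: "('a::field poly fract \<Rightarrow> 'e::field) \<Rightarrow> 'e set \<Rightarrow> 'a \<Rightarrow> bool" where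
  "lies_over emb J \<mu> \<longleftrightarrow> {a. emb (Fract a 1) \<in> J} = {a. [:- \<mu>, 1:] dvd a}"

definition frobenius_at ::
  "('a::{field,finite} poly fract \<Rightarrow> 'e::field) \<Rightarrow> 'e set \<Rightarrow> ('e \<Rightarrow> 'e) \<Rightarrow> bool" where
  "frobenius_at emb J \<sigma> \<longleftrightarrow> \<sigma> \<in> gal_group emb \<and> \<sigma> ` J = J \<and>
     (\<forall>z\<in>int_closure emb. \<sigma> z - z ^ CARD('a) \<in> J)"

definition scal :: "('a::field poly fract \<Rightarrow> 'e::field) \<Rightarrow> 'a \<Rightarrow> 'e \<Rightarrow> 'e" where
  "scal emb c x = emb (const_ff c) * x"

definition inv_symplectic_form ::
  "('a::field poly fract \<Rightarrow> 'e::field) \<Rightarrow> 'e set \<Rightarrow> ('e \<Rightarrow> 'e) set \<Rightarrow> ('e \<Rightarrow> 'e \<Rightarrow> 'a) \<Rightarrow> bool" where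
  "inv_symplectic_form emb V G B \<longleftrightarrow>
     (\<forall>x\<in>V. \<forall>y\<in>V. \<forall>z\<in>V. B (x + y) z = B x z + B y z \<and> B z (x + y) = B z x + B z y) \<and>
     (\<forall>c. \<forall>x\<in>V. \<forall>y\<in>V. B (scal emb c x) y = c * B x y \<and> B x (scal emb c y) = c * B x y) \<and>
     (\<forall>x\<in>V. B x x = 0) \<and>
     (\<forall>x\<in>V. (\<forall>y\<in>V. B x y = 0) \<longrightarrow> x = 0) \<and>
     (\<forall>\<sigma>\<in>G. \<forall>x\<in>V. \<forall>y\<in>V. B (\<sigma> x) (\<sigma> y) = B x y)"

text \<open>tau acts on V as a symplectic transvection w.r.t. B: it preserves B,
  its minimal polynomial on V is (x-1)^2, and tau - I has rank one on V.\<close>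
definition symplectic_transvection ::
  "('a::field poly fract \<Rightarrow> 'e::field) \<Rightarrow> 'e set \<Rightarrow> ('e \<Rightarrow> 'e \<Rightarrow> 'a) \<Rightarrow> ('e \<Rightarrow> 'e) \<Rightarrow> bool" where
  "symplectic_transvection emb V B \<tau> \<longleftrightarrow>
     \<tau> ` V = V \<and>
     (\<forall>x\<in>V. \<forall>y\<in>V. B (\<tau> x) (\<tau> y) = B x y) \<and>
     (\<exists>x\<in>V. \<tau> x \<noteq> x) \<and>
     (\<forall>x\<in>V. \<tau> (\<tau> x - x) - (\<tau> x - x) = 0) \<and>
     (\<exists>v\<in>V. v \<noteq> 0 \<and> (\<forall>x\<in>V. \<exists>c. \<tau> x - x = scal emb c v))"

end

theory Submission
  imports Defs "Jordan_Normal_Form.Char_Poly" "HOL-Algebra.Algebraic_Closure_Type"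
begin

hide_const (open) up_ring.monom up_ring.coeff Coset.order Polynomials.degree Polynomials.lead_coeff
  Module.smult

text \<open>
  Take the prime \<open>t = 0\<close>. Over an algebraic closure \<open>k\<close> of \<open>F\<^sub>q\<close> the reduction \<open>\<Phi>\<close> of \<open>L\<close> is separable, and
  each of its roots lifts to a unique root of \<open>L\<close> in \<open>k[[t]]\<close>. Hence \<open>E\<close> embeds into \<open>k((t))\<close>; raising
  coefficients to the \<open>q\<close>-th power restricts to a Frobenius element \<open>\<sigma>\<close> for the prime of integral
  elements with vanishing constant term, and taking constant terms identifies \<open>V\<close> with the roots of \<open>\<Phi>\<close>,
  on which \<open>\<sigma>\<close> is \<open>a \<mapsto> a\<^sup>q\<close>, an operator with annihilator \<open>M\<close>.
  If \<open>e = q\<^sup>n - 1\<close> is a period of the squarefree part \<open>M\<^sub>1\<close>, then \<open>M\<close> divides \<open>(X - 1)(X\<^sup>e - 1)\<close> but not \<open>X\<^sup>e - 1\<close>,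
  so \<open>\<sigma>\<^sup>e - 1\<close> is nonzero with image in the fixed line \<open>F\<^sub>q\<close>.
  The invariant form is an explicit alternating \<open>q\<close>-bilinear expression \<open>W(x, y)\<close> for which the palindromic
  shape of \<open>L\<close> gives \<open>W\<^sup>q = W\<close> on \<open>V\<close>.
\<close>

section \<open>Finite fields and their Frobenius\<close>

text \<open>The exponent \<open>e = q^n - 1\<close> does two jobs at once. Being a period of
  \<open>M1\<close>, it kills the part of the Frobenius belonging to \<open>M1\<close>; on the block
  with annihilator \<open>(X - 1)^2\<close> it sends \<open>1 + N\<close>, with
  \<open>N^2 = 0\<close>, to \<open>1 + e N = 1 - N\<close>, because \<open>e\<close> equals -1 in
  F_q. So exactly one nontrivial Jordan block of size two survives. The line it maps onto is visible
  beforehand: \<open>M(1) = 0\<close> says that the elements of F_q are themselves roots of \<Phi>.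

  The prime t = 0 is a good choice because the coefficient of x in \<Phi> is
  \<open>M(0) = 1\<close>: this makes the derivative of \<Phi> the constant 1 and lets the
  coefficients of a power series root be solved for one after the other.

  The obstacle is that E is an arbitrary field known only through the splitting property. It is
  compared with k((t)) by extending the inclusion of F_q(t) root by root. Prime, residue map and
  Frobenius are then pulled back along the resulting embedding, which replaces the general theory of
  decomposition groups.\<close>

lemma finite_field_pow_card:
  fixes x :: "'a::{field,finite}"
  shows "x ^ CARD('a) = x"
proof (cases "x = 0")
  case False
  have "bij_betw ((*) x) (UNIV - {0}) (UNIV - {0})"
    by (rule bij_betwI[of _ _ _ "\<lambda>y. y / x"]) (use False in auto)
  then have "(\<Prod>y\<in>UNIV - {0}. x * y) = \<Prod>(UNIV - {0})"
    by (rule prod.reindex_bij_betw)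
  then have "x ^ (CARD('a) - 1) * \<Prod>(UNIV - {0}) = \<Prod>(UNIV - {0})"
    by (simp add: prod.distrib card_Diff_singleton)
  moreover have "\<Prod>(UNIV - {0::'a}) \<noteq> 0" by simp
  ultimately have "x ^ (CARD('a) - 1) = 1" by simp
  then have "x * x ^ (CARD('a) - 1) = x" by simp
  then show ?thesis by (metis power_eq_if zero_less_card_finite less_numeral_extra(3))
qed (simp add: zero_power zero_less_card_finite)

lemma one_less_card_field: "1 < CARD('a::{field,finite})"
proof -
  have "card {0, 1 :: 'a} \<le> CARD('a)" by (rule card_mono) auto
  then show ?thesis by simp
qed

lemma poly_eq_0_if_many_roots:
  fixes p :: "'a::idom poly"
  assumes "\<And>x. x \<in> A \<Longrightarrow> poly p x = 0" "degree p < card A"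
  shows "p = 0"
proof (rule ccontr)
  assume "p \<noteq> 0"
  then have "card A \<le> card {x. poly p x = 0}"
    by (intro card_mono poly_roots_finite) (use assms in auto)
  also have "\<dots> \<le> degree p" using \<open>p \<noteq> 0\<close> by (rule card_poly_roots_bound)
  finally show False using assms(2) by simp
qed

text \<open>The polynomial \<open>(X+1)^q - X^q - 1\<close> has degree below \<open>q\<close> but vanishes on all \<open>q\<close> elements.\<close>

lemma of_nat_card_choose_eq_0:
  assumes "0 < i" "i < CARD('a::{field,finite})"
  shows "of_nat (CARD('a) choose i) = (0::'a)"
proof -
  let ?q = "CARD('a)"
  define p where "p = (\<Sum>j\<in>{0<..<?q}. monom (of_nat (?q choose j)) j :: 'a poly)"
  have q: "1 < ?q" by (rule one_less_card_field)
  have "degree p \<le> ?q - 1" unfolding p_def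
    by (rule degree_sum_le) (auto intro: order.trans[OF degree_monom_le])
  moreover have "poly p x = 0" for x
  proof -
    have "(x + 1) ^ ?q = (\<Sum>j\<le>?q. of_nat (?q choose j) * x ^ j)"
      by (simp add: binomial_ring)
    also have "{..?q} = insert 0 (insert ?q {0<..<?q})" using q by auto
    also have "(\<Sum>j\<in>\<dots>. of_nat (?q choose j) * x ^ j) = 1 + (x ^ ?q + poly p x)"
      using q by (simp add: p_def poly_sum poly_monom)
    finally show ?thesis by (simp add: finite_field_pow_card)
  qed
  ultimately have "p = 0" using q
    by (intro poly_eq_0_if_many_roots[of UNIV]) auto
  then have "coeff p i = 0" by simp
  then show ?thesis using assms by (simp add: p_def coeff_sum if_distrib sum.delta cong: if_cong)
qed

text \<open>The codomain is only a commutative ring because additivity of the \<open>q\<close>-th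
  power is also needed for polynomials (\<open>frobenius_poly_diff\<close>) and for power series
  (\<open>fps_frob_nth\<close>).\<close>

locale fq_algebra = comm_ring_hom h for h :: "'a::{field,finite} \<Rightarrow> 'b::comm_ring_1"
begin

lemma frob_add: "(x + y :: 'b) ^ CARD('a) = x ^ CARD('a) + y ^ CARD('a)"
proof -
  have q: "1 < CARD('a)" by (rule one_less_card_field)
  have z: "of_nat (CARD('a) choose j) = (0::'b)" if "j \<in> {0<..<CARD('a)}" for j
    using of_nat_card_choose_eq_0[where 'a='a, of j] that
    by (metis greaterThanLessThan_iff hom_of_nat hom_zero)
  have "(x + y) ^ CARD('a) = (\<Sum>j\<le>CARD('a). of_nat (CARD('a) choose j) * x ^ j * y ^ (CARD('a) - j))"
    by (rule binomial_ring)
  also have "{..CARD('a)} = insert 0 (insert CARD('a) {0<..<CARD('a)})" using q by auto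
  also have "(\<Sum>j\<in>\<dots>. of_nat (CARD('a) choose j) * x ^ j * y ^ (CARD('a) - j)) = x ^ CARD('a) + y ^ CARD('a)"
    using q z by simp
  finally show ?thesis .
qed

lemma frob_zero: "(0::'b) ^ CARD('a) = 0"
  using one_less_card_field[where 'a='a] by (simp add: zero_power)

lemma frob_uminus: "(- x :: 'b) ^ CARD('a) = - (x ^ CARD('a))"
  using frob_add[of x "-x"] frob_zero by (simp add: eq_neg_iff_add_eq_0 add.commute)

lemma frob_diff: "(x - y :: 'b) ^ CARD('a) = x ^ CARD('a) - y ^ CARD('a)"
  using frob_add[of x "-y"] by (simp add: frob_uminus)

lemma frob_sum: "(\<Sum>i\<in>A. f i :: 'b) ^ CARD('a) = (\<Sum>i\<in>A. f i ^ CARD('a))"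
  by (induction A rule: infinite_finite_induct) (auto simp: frob_add frob_zero)

lemma frob_h: "h c ^ CARD('a) = h c"
  by (simp add: finite_field_pow_card flip: hom_power)

lemma frob_pow_h: "h c ^ (CARD('a) ^ i) = h c"
  by (induction i) (simp_all add: power_mult frob_h)

lemma frob_pow_zero: "(0::'b) ^ (CARD('a) ^ i) = 0"
  by (simp add: zero_power)

lemma frob_pow_add: "(x + y :: 'b) ^ (CARD('a) ^ i) = x ^ (CARD('a) ^ i) + y ^ (CARD('a) ^ i)"
  by (induction i) (simp_all add: power_mult frob_add mult.commute[of "CARD('a)"])

lemma frob_pow_diff: "(x - y :: 'b) ^ (CARD('a) ^ i) = x ^ (CARD('a) ^ i) - y ^ (CARD('a) ^ i)"
  by (induction i) (simp_all add: power_mult frob_diff mult.commute[of "CARD('a)"])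

lemma frob_pow_sum: "(\<Sum>j\<in>A. f j :: 'b) ^ (CARD('a) ^ i) = (\<Sum>j\<in>A. f j ^ (CARD('a) ^ i))"
  by (induction A rule: infinite_finite_induct) (auto simp: frob_pow_add frob_pow_zero)

end

section \<open>Field extensions of F_q and their q-polynomials\<close>

locale fq_hom = field_hom h for h :: "'a::{field,finite} \<Rightarrow> 'b::field"
begin

sublocale fq_algebra h by unfold_locales

text \<open>\<open>X^q - X\<close> has at most \<open>q\<close> roots, and the \<open>q\<close>
  elements of \<open>range h\<close> already exhaust them. Values of the form and coefficients of
  the transvection are recognised as scalars in this way.\<close>

lemma frob_fixed_imp_h:
  assumes "x ^ CARD('a) = x"
  shows "x \<in> range h"
proof (rule ccontr)
  assume x: "x \<notin> range h"
  define p where "p = monom (1::'b) CARD('a) - monom 1 1"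
  have q: "1 < CARD('a)" by (rule one_less_card_field)
  have c: "card (insert x (range h)) = Suc CARD('a)"
    using x by (simp add: card_image inj_on_def)
  have "p = 0"
  proof (rule poly_eq_0_if_many_roots)
    have "degree p \<le> CARD('a)" unfolding p_def
      by (rule degree_diff_le; rule order.trans[OF degree_monom_le]) (use q in auto)
    then show "degree p < card (insert x (range h))" using c by simp
    show "poly p y = 0" if "y \<in> insert x (range h)" for y
      using that assms by (auto simp: p_def poly_monom frob_h)
  qed
  moreover have "coeff p CARD('a) = 1" using q by (simp add: p_def)
  ultimately show False by simp
qed

text \<open>The \<open>q\<close>-polynomial associated with \<open>P\<close>, that is,
  \<open>P\<close> evaluated at the operator \<open>y \<mapsto> y^q\<close>. As that operator fixes
  the coefficients, products of polynomials become compositions (\<open>qact_mult\<close>).\<close>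

definition qact :: "'a poly \<Rightarrow> 'b \<Rightarrow> 'b" where
  "qact P x = (\<Sum>i\<le>degree P. h (coeff P i) * x ^ (CARD('a) ^ i))"

lemma qact_eq_sum: "degree P \<le> n \<Longrightarrow> qact P x = (\<Sum>i\<le>n. h (coeff P i) * x ^ (CARD('a) ^ i))"
  unfolding qact_def by (rule sum.mono_neutral_left) (auto simp: coeff_eq_0)

lemma qact_0 [simp]: "qact 0 x = 0"
  by (simp add: qact_def)

lemma qact_pCons: "qact (pCons a P) x = h a * x + qact P x ^ CARD('a)"
proof -
  have "qact (pCons a P) x = (\<Sum>i\<le>Suc (degree P). h (coeff (pCons a P) i) * x ^ (CARD('a) ^ i))"
    by (rule qact_eq_sum) (simp add: degree_pCons_le)
  also have "\<dots> = h a * x + (\<Sum>i\<le>degree P. h (coeff P i) * x ^ (CARD('a) ^ i * CARD('a)))"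
    by (simp add: sum.atMost_Suc_shift mult.commute[of "CARD('a)"] del: sum.atMost_Suc)
  also have "(\<Sum>i\<le>degree P. h (coeff P i) * x ^ (CARD('a) ^ i * CARD('a))) = qact P x ^ CARD('a)"
    by (simp add: qact_def frob_sum power_mult power_mult_distrib frob_h)
  finally show ?thesis .
qed

lemma qact_add: "qact (P + Q) x = qact P x + qact Q x"
proof -
  let ?n = "max (degree P) (degree Q)"
  have "degree (P + Q) \<le> ?n" by (rule degree_add_le_max)
  then show ?thesis
    by (simp add: qact_eq_sum[of _ ?n] hom_add algebra_simps sum.distrib)
qed

lemma qact_diff: "qact (P - Q) x = qact P x - qact Q x"
  using qact_add[of "P - Q" Q x] by (simp add: algebra_simps)

lemma qact_smult: "qact (smult c P) x = h c * qact P x"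
  by (simp add: qact_eq_sum[of _ "degree P"] hom_mult sum_distrib_left algebra_simps degree_smult_le)

lemma qact_add_right: "qact P (x + y) = qact P x + qact P y"
  by (simp add: qact_def frob_pow_add algebra_simps sum.distrib)

lemma qact_zero_right [simp]: "qact P 0 = 0"
  by (simp add: qact_def frob_pow_zero)

lemma qact_scale_right: "qact P (h c * x) = h c * qact P x"
  by (simp add: qact_def power_mult_distrib frob_pow_h sum_distrib_left algebra_simps)

lemma qact_mult: "qact (P * Q) x = qact P (qact Q x)"
proof (induction P)
  case (pCons a P)
  have "qact (pCons a P * Q) x = qact (smult a Q) x + qact (pCons 0 (P * Q)) x"
    by (simp add: qact_add)
  also have "\<dots> = h a * qact Q x + qact P (qact Q x) ^ CARD('a)"
    by (simp add: qact_smult qact_pCons pCons.IH)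
  finally show ?case by (simp add: qact_pCons)
qed simp

lemma qact_monom: "qact (monom 1 k) x = x ^ (CARD('a) ^ k)"
  by (induction k) (simp_all add: monom_Suc qact_pCons monom_0 power_mult mult.commute[of "CARD('a)"])

lemma qact_eq_0_if_dvd: "Q dvd P \<Longrightarrow> qact Q x = 0 \<Longrightarrow> qact P x = 0"
  by (auto simp: mult.commute[of Q] qact_mult elim!: dvdE)

end

lemma card_pow_strict_mono: "i < j \<Longrightarrow> CARD('a::{field,finite}) ^ i < CARD('a) ^ j"
  using one_less_card_field[where 'a='a] by (simp add: power_strict_increasing)

text \<open>As a polynomial in \<open>y\<close> the sum has degree at most \<open>q^(n-1)\<close>,
  too small for \<open>q^n\<close> zeros, and distinct \<open>i\<close> give distinct exponents.
  Both the nondegeneracy of the form and the nontriviality of the transvection rest on this.\<close>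

lemma linearized_coeff_eq_0:
  fixes a :: "nat \<Rightarrow> 'b::field"
  assumes "\<And>y. y \<in> A \<Longrightarrow> (\<Sum>i<n. a i * y ^ (CARD('a::{field,finite}) ^ i)) = 0"
    and "CARD('a) ^ n \<le> card A" "k < n"
  shows "a k = 0"
proof -
  let ?q = "CARD('a)"
  define p where "p = (\<Sum>i<n. monom (a i) (?q ^ i))"
  have "p = 0"
  proof (rule poly_eq_0_if_many_roots)
    show "poly p y = 0" if "y \<in> A" for y
      using assms(1)[OF that] by (simp add: p_def poly_sum poly_monom)
    have "degree p \<le> ?q ^ (n - 1)" unfolding p_def
      by (rule degree_sum_le)
         (use one_less_card_field[where 'a='a] in \<open>auto intro!: order.trans[OF degree_monom_le] power_increasing\<close>)
    also have "\<dots> < ?q ^ n" using assms(3) by (intro card_pow_strict_mono) auto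
    finally show "degree p < card A" using assms(2) by simp
  qed
  then have "0 = coeff p (?q ^ k)" by simp
  also have "\<dots> = (\<Sum>i<n. if i = k then a i else 0)" unfolding p_def coeff_sum
    by (rule sum.cong) (use one_less_card_field[where 'a='a] in \<open>auto simp: power_inject_exp\<close>)
  also have "\<dots> = a k" using assms(3) by simp
  finally show ?thesis by simp
qed

section \<open>Integral elements form a ring\<close>

locale base_hom = comm_ring_hom h for h :: "'r::idom \<Rightarrow> 'e::field"
begin

definition integral :: "'e \<Rightarrow> bool" where
  "integral z \<longleftrightarrow> (\<exists>p. lead_coeff p = 1 \<and> poly (map_poly h p) z = 0)"

text \<open>The module spanned by \<open>W\<close> over the image of \<open>h\<close>, generated one
  term at a time so that claims about it reduce by induction to single generators.\<close>

inductive_set hspan :: "'e set \<Rightarrow> 'e set" for W where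
  hspan_0: "0 \<in> hspan W"
| hspan_step: "w \<in> W \<Longrightarrow> v \<in> hspan W \<Longrightarrow> h a * w + v \<in> hspan W"

lemma hspan_base: "w \<in> W \<Longrightarrow> w \<in> hspan W"
  using hspan_step[of w W 0 1] by (simp add: hspan_0)

lemma hspan_add: "x \<in> hspan W \<Longrightarrow> y \<in> hspan W \<Longrightarrow> x + y \<in> hspan W"
  by (induction rule: hspan.induct) (auto simp: add.assoc intro: hspan.intros)

lemma hspan_scale: "x \<in> hspan W \<Longrightarrow> h b * x \<in> hspan W"
proof (induction rule: hspan.induct)
  case (hspan_step w v a)
  then have "h (b * a) * w + h b * v \<in> hspan W" by (intro hspan.hspan_step)
  then show ?case by (simp add: algebra_simps hom_mult)
qed (simp add: hspan_0)

lemma hspan_sum: "(\<And>i. i \<in> I \<Longrightarrow> f i \<in> hspan W) \<Longrightarrow> (\<Sum>i\<in>I. f i) \<in> hspan W"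
  by (induction I rule: infinite_finite_induct) (auto intro: hspan_0 hspan_add)

lemma hspan_mult_subset:
  assumes "x \<in> hspan W" "\<And>w. w \<in> W \<Longrightarrow> z * w \<in> hspan U"
  shows "z * x \<in> hspan U"
  using assms(1)
proof (induction rule: hspan.induct)
  case (hspan_step w v a)
  then have "h a * (z * w) + z * v \<in> hspan U"
    using assms(2) by (intro hspan_add hspan_scale)
  then show ?case by (simp add: algebra_simps)
qed (simp add: hspan_0)

lemma hspan_imp_sum:
  assumes "finite W" "x \<in> hspan W"
  shows "\<exists>c. x = (\<Sum>u\<in>W. h (c u) * u)"
  using assms(2)
proof (induction rule: hspan.induct)
  case hspan_0
  show ?case by (rule exI[of _ "\<lambda>_. 0"]) simp
next
  case (hspan_step w v a)
  then obtain c where c: "v = (\<Sum>u\<in>W. h (c u) * u)" by auto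
  have "h a * w + v = (\<Sum>u\<in>W. h (c u + (if u = w then a else 0)) * u)"
  proof -
    have "h a * w = (\<Sum>u\<in>W. h (if u = w then a else 0) * u)"
      using assms(1) hspan_step by (subst sum.remove[of _ w]) auto
    then show ?thesis by (simp add: c hom_add algebra_simps sum.distrib)
  qed
  then show ?case by (rule exI[where x = "\<lambda>u. c u + (if u = w then a else 0)"])
qed

text \<open>The determinant trick: \<open>z\<close> is an eigenvalue of its matrix on the generators \<open>W\<close>.\<close>

lemma integral_if_stable:
  assumes fin: "finite W" and one: "1 \<in> W" and st: "\<And>w. w \<in> W \<Longrightarrow> z * w \<in> hspan W"
  shows "integral z"
proof -
  have "\<forall>w\<in>W. \<exists>c. z * w = (\<Sum>u\<in>W. h (c u) * u)"
    using hspan_imp_sum[OF fin] st by blast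
  then obtain c where c: "\<And>w. w \<in> W \<Longrightarrow> z * w = (\<Sum>u\<in>W. h (c w u) * u)"
    by metis
  obtain ws where ws: "set ws = W" "distinct ws"
    using finite_distinct_list[OF fin] by blast
  define n where "n = length ws"
  define A where "A = mat n n (\<lambda>(i,j). c (ws ! i) (ws ! j))"
  define v where "v = vec n (\<lambda>i. ws ! i)"
  have A: "A \<in> carrier_mat n n" by (simp add: A_def)
  have hA: "map_mat h A \<in> carrier_mat n n" by (simp add: A_def)
  have v: "v \<in> carrier_vec n" by (simp add: v_def)
  have mem: "ws ! i \<in> W" if "i < n" for i using that ws n_def by auto
  \<comment> \<open>The entry 1 makes the vector of generators nonzero, as an eigenvector must
    be.\<close>
  obtain i where i: "i < n" "ws ! i = 1"
    using one ws by (metis in_set_conv_nth n_def)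
  have v0: "v \<noteq> 0\<^sub>v n"
  proof
    assume "v = 0\<^sub>v n"
    then have "vec_index v i = 0" using i by simp
    then show False using i by (simp add: v_def)
  qed
  have "map_mat h A *\<^sub>v v = z \<cdot>\<^sub>v v"
  proof (rule eq_vecI)
    show "dim_vec (map_mat h A *\<^sub>v v) = dim_vec (z \<cdot>\<^sub>v v)" by (simp add: A_def v_def)
    fix i assume "i < dim_vec (z \<cdot>\<^sub>v v)"
    then have i: "i < n" by (simp add: v_def)
    have "vec_index (map_mat h A *\<^sub>v v) i = (\<Sum>j<n. h (c (ws ! i) (ws ! j)) * ws ! j)"
      using i by (simp add: A_def v_def scalar_prod_def atLeast0LessThan)
    also have "\<dots> = (\<Sum>u\<in>W. h (c (ws ! i) u) * u)"
      by (rule sum.reindex_bij_betw) (use bij_betw_nth[OF ws(2), of "{..<n}" W] ws n_def in auto)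
    also have "\<dots> = z * ws ! i" using c[OF mem[OF i]] by simp
    finally show "vec_index (map_mat h A *\<^sub>v v) i = vec_index (z \<cdot>\<^sub>v v) i" using i by (simp add: v_def)
  qed
  then have "eigenvalue (map_mat h A) z"
    unfolding eigenvalue_def eigenvector_def using v v0 A by (auto simp: A_def)
  then have "poly (char_poly (map_mat h A)) z = 0"
    using eigenvalue_root_char_poly[OF hA] by simp
  then have "poly (map_poly h (char_poly A)) z = 0"
    by (simp add: char_poly_hom[OF A])
  then show ?thesis unfolding integral_def using degree_monic_char_poly[OF A] by blast
qed

text \<open>The powers of \<open>z\<close> below the degree of a monic equation will do, since the
  equation rewrites the next power. With the converse \<open>integral_if_stable\<close>, closure
  under sums and products reduces to finding a common stable module.\<close>

lemma integral_imp_stable: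
  assumes "integral z"
  shows "\<exists>W. finite W \<and> 1 \<in> W \<and> (\<forall>w\<in>W. z * w \<in> hspan W)"
proof -
  obtain p where p: "lead_coeff p = 1" "poly (map_poly h p) z = 0"
    using assms unfolding integral_def by blast
  define n where "n = degree p"
  have co: "coeff p n = 1" using p(1) by (simp add: n_def)
  have "degree (map_poly h p) = n" unfolding n_def
    by (rule degree_map_poly) (use p in auto)
  then have ev: "(\<Sum>i\<le>n. h (coeff p i) * z ^ i) = 0"
    using p(2) by (simp add: poly_altdef coeff_map_poly)
  have n: "n > 0" using ev co by (cases n) auto
  define W where "W = (\<lambda>i. z ^ i) ` {..<n}"
  have zi: "z ^ i \<in> hspan W" if "i < n" for i
    by (rule hspan_base) (use that in \<open>auto simp: W_def\<close>)
  have "z * w \<in> hspan W" if w: "w \<in> W" for w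
  proof -
    obtain i where i: "i < n" "w = z ^ i" using w by (auto simp: W_def)
    show ?thesis
    proof (cases "Suc i < n")
      case True
      then show ?thesis using zi[of "Suc i"] i by simp
    next
      case False
      then have "Suc i = n" using i by simp
      then have "z * w = z ^ n" using i by auto
      also have "\<dots> = (\<Sum>i<n. h (- coeff p i) * z ^ i)"
        using ev co by (simp add: lessThan_Suc_atMost[symmetric] sum_negf hom_uminus eq_neg_iff_add_eq_0 add.commute)
      also have "\<dots> \<in> hspan W" by (intro hspan_sum hspan_scale zi) auto
      finally show ?thesis .
    qed
  qed
  moreover have "1 \<in> W" unfolding W_def using n by (auto intro!: image_eqI[of _ _ 0])
  ultimately show ?thesis by (intro exI[of _ W]) (auto simp: W_def)
qed

text \<open>Products of generators work: \<open>x\<close> acts on the first factor only and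
  \<open>y\<close> on the second only.\<close>

lemma integral_common_stable:
  assumes "integral x" "integral y"
  obtains W where "finite W" "1 \<in> W"
    "\<And>v. v \<in> hspan W \<Longrightarrow> x * v \<in> hspan W" "\<And>v. v \<in> hspan W \<Longrightarrow> y * v \<in> hspan W"
proof -
  obtain U where U: "finite U" "1 \<in> U" "\<And>w. w \<in> U \<Longrightarrow> x * w \<in> hspan U"
    using integral_imp_stable[OF assms(1)] by blast
  obtain V where V: "finite V" "1 \<in> V" "\<And>w. w \<in> V \<Longrightarrow> y * w \<in> hspan V"
    using integral_imp_stable[OF assms(2)] by blast
  define W where "W = (\<lambda>(a,b). a * b) ` (U \<times> V)"
  have W: "a * b \<in> hspan W" if "a \<in> U" "b \<in> V" for a b
    by (rule hspan_base) (use that in \<open>auto simp: W_def\<close>)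
  have "x * w \<in> hspan W" if w: "w \<in> W" for w
  proof -
    obtain a b where ab: "a \<in> U" "b \<in> V" "w = a * b" using w by (auto simp: W_def)
    have "b * (x * a) \<in> hspan W"
      by (rule hspan_mult_subset[OF U(3)[OF ab(1)]]) (use W ab in \<open>simp add: mult.commute\<close>)
    then show ?thesis using ab by (simp add: algebra_simps)
  qed
  moreover have "y * w \<in> hspan W" if w: "w \<in> W" for w
  proof -
    obtain a b where ab: "a \<in> U" "b \<in> V" "w = a * b" using w by (auto simp: W_def)
    have "a * (y * b) \<in> hspan W"
      by (rule hspan_mult_subset[OF V(3)[OF ab(2)]]) (use W ab in blast)
    then show ?thesis using ab by (simp add: algebra_simps)
  qed
  moreover have "finite W" using U V by (simp add: W_def)
  moreover have "1 \<in> W" unfolding W_def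
    by (rule image_eqI[of _ _ "(1,1)"]) (use U V in auto)
  ultimately show thesis using that hspan_mult_subset by blast
qed

lemma integral_add: assumes "integral x" "integral y" shows "integral (x + y)"
  using assms
proof (rule integral_common_stable)
  fix W assume W: "finite W" "1 \<in> W"
    "\<And>v. v \<in> hspan W \<Longrightarrow> x * v \<in> hspan W" "\<And>v. v \<in> hspan W \<Longrightarrow> y * v \<in> hspan W"
  show ?thesis
    by (rule integral_if_stable[of W]) (use W in \<open>auto simp: distrib_right intro: hspan_add hspan_base\<close>)
qed

lemma integral_mult: assumes "integral x" "integral y" shows "integral (x * y)"
  using assms
proof (rule integral_common_stable)
  fix W assume W: "finite W" "1 \<in> W"
    "\<And>v. v \<in> hspan W \<Longrightarrow> x * v \<in> hspan W" "\<And>v. v \<in> hspan W \<Longrightarrow> y * v \<in> hspan W"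
  show ?thesis
    by (rule integral_if_stable[of W]) (use W in \<open>auto simp: mult.assoc intro: hspan_base\<close>)
qed

lemma integral_base: "integral (h a)"
  unfolding integral_def by (rule exI[of _ "[:-a, 1:]"]) (simp add: hom_uminus)

lemma integral_0: "integral 0" and integral_1: "integral 1"
  using integral_base[of 0] integral_base[of 1] by simp_all

lemma integral_uminus: "integral x \<Longrightarrow> integral (- x)"
  using integral_mult[OF integral_base[of "-1"], of x] by (simp add: hom_uminus)

lemma integral_diff: "integral x \<Longrightarrow> integral y \<Longrightarrow> integral (x - y)"
  using integral_add[of x "- y"] integral_uminus by simp

lemma integral_power: "integral x \<Longrightarrow> integral (x ^ n)"
  by (induction n) (auto intro: integral_mult integral_1)

end

section \<open>Extending field homomorphisms\<close>

definition coeffs_in :: "'e::field set \<Rightarrow> 'e poly \<Rightarrow> bool" where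
  "coeffs_in S p \<longleftrightarrow> (\<forall>i. coeff p i \<in> S)"

text \<open>Intermediate fields are sets rather than types, so a homomorphism on one of them is a
  total function constrained on that set only.\<close>

definition hom_on :: "'e::field set \<Rightarrow> ('e \<Rightarrow> 'f::field) \<Rightarrow> bool" where
  "hom_on S g \<longleftrightarrow> g 1 = 1 \<and> (\<forall>x\<in>S. \<forall>y\<in>S. g (x + y) = g x + g y \<and> g (x * y) = g x * g y)"

locale subfield_hom =
  fixes S :: "'e::field set" and g :: "'e \<Rightarrow> 'f::field"
  assumes sub: "is_subfield S" and hom: "hom_on S g"
begin

lemma S_0: "0 \<in> S" and S_1: "1 \<in> S"
  and S_add: "x \<in> S \<Longrightarrow> y \<in> S \<Longrightarrow> x + y \<in> S"
  and S_mult: "x \<in> S \<Longrightarrow> y \<in> S \<Longrightarrow> x * y \<in> S"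
  and S_uminus: "x \<in> S \<Longrightarrow> - x \<in> S"
  and S_inverse: "x \<in> S \<Longrightarrow> inverse x \<in> S"
  using sub by (auto simp: is_subfield_def)

lemma S_diff: "x \<in> S \<Longrightarrow> y \<in> S \<Longrightarrow> x - y \<in> S"
  using S_add[of x "-y"] S_uminus by simp

lemma S_sum: "(\<And>i. i \<in> A \<Longrightarrow> f i \<in> S) \<Longrightarrow> (\<Sum>i\<in>A. f i) \<in> S"
  by (induction A rule: infinite_finite_induct) (auto intro: S_0 S_add)

lemma g_1: "g 1 = 1"
  and g_add: "x \<in> S \<Longrightarrow> y \<in> S \<Longrightarrow> g (x + y) = g x + g y"
  and g_mult: "x \<in> S \<Longrightarrow> y \<in> S \<Longrightarrow> g (x * y) = g x * g y"
  using hom by (auto simp: hom_on_def)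

lemma g_0: "g 0 = 0"
  using g_add[OF S_0 S_0] by (metis add_0 add_cancel_right_left)

lemma g_uminus: "x \<in> S \<Longrightarrow> g (- x) = - g x"
  using g_add[of x "-x"] S_uminus[of x] g_0 by (simp add: eq_neg_iff_add_eq_0 add.commute)

lemma g_diff: "x \<in> S \<Longrightarrow> y \<in> S \<Longrightarrow> g (x - y) = g x - g y"
  using g_add[of x "-y"] S_uminus[of y] g_uminus[of y] by simp

lemma g_sum: "(\<And>i. i \<in> A \<Longrightarrow> f i \<in> S) \<Longrightarrow> g (\<Sum>i\<in>A. f i) = (\<Sum>i\<in>A. g (f i))"
  by (induction A rule: infinite_finite_induct) (auto simp: g_0 g_add S_sum)

lemma g_eq_0D: "x \<in> S \<Longrightarrow> g x = 0 \<Longrightarrow> x = 0"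
  using g_mult[of x "inverse x"] S_inverse[of x] g_1 by (cases "x = 0") auto

lemma coeffs_in_add: "coeffs_in S p \<Longrightarrow> coeffs_in S r \<Longrightarrow> coeffs_in S (p + r)"
  and coeffs_in_diff: "coeffs_in S p \<Longrightarrow> coeffs_in S r \<Longrightarrow> coeffs_in S (p - r)"
  and coeffs_in_uminus: "coeffs_in S p \<Longrightarrow> coeffs_in S (- p)"
  and coeffs_in_0: "coeffs_in S 0"
  by (auto simp: coeffs_in_def intro: S_add S_diff S_uminus S_0)

lemma coeffs_in_mult: "coeffs_in S p \<Longrightarrow> coeffs_in S r \<Longrightarrow> coeffs_in S (p * r)"
  unfolding coeffs_in_def coeff_mult by (intro allI S_sum S_mult) auto

lemma coeffs_in_monom: "c \<in> S \<Longrightarrow> coeffs_in S (monom c n)"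
  by (auto simp: coeffs_in_def S_0)

lemma coeffs_in_const: "c \<in> S \<Longrightarrow> coeffs_in S [:c:]"
  using coeffs_in_monom[of c 0] by (simp add: monom_0)

lemma coeff_gmap [simp]: "coeff (map_poly g p) i = g (coeff p i)"
  by (simp add: coeff_map_poly g_0)

lemma gmap_const: "map_poly g [:c:] = [:g c:]"
  by (rule poly_eqI) (simp add: coeff_pCons g_0 split: nat.split)

lemma gmap_add: "coeffs_in S p \<Longrightarrow> coeffs_in S r \<Longrightarrow> map_poly g (p + r) = map_poly g p + map_poly g r"
  by (rule poly_eqI) (auto simp: coeffs_in_def g_add)

lemma gmap_diff: "coeffs_in S p \<Longrightarrow> coeffs_in S r \<Longrightarrow> map_poly g (p - r) = map_poly g p - map_poly g r"
  by (rule poly_eqI) (auto simp: coeffs_in_def g_diff)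

lemma gmap_mult: "coeffs_in S p \<Longrightarrow> coeffs_in S r \<Longrightarrow> map_poly g (p * r) = map_poly g p * map_poly g r"
  by (rule poly_eqI) (auto simp: coeffs_in_def coeff_mult g_sum g_mult S_mult)

lemma degree_gmap: "coeffs_in S p \<Longrightarrow> degree (map_poly g p) = degree p"
  by (cases "p = 0", simp, rule degree_map_poly) (metis coeffs_in_def g_eq_0D leading_coeff_0_iff)

lemma gmap_eq_0D: "coeffs_in S p \<Longrightarrow> map_poly g p = 0 \<Longrightarrow> p = 0"
  by (metis coeff_0 coeff_gmap coeffs_in_def g_eq_0D poly_eqI)

text \<open>Cancelling leading terms uses field operations of \<open>S\<close> only, so quotient and
  remainder keep their coefficients in \<open>S\<close>.\<close>

lemma coeffs_in_division:
  assumes "coeffs_in S P" "P \<noteq> 0" "coeffs_in S Q"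
  shows "\<exists>D R. coeffs_in S D \<and> coeffs_in S R \<and> Q = D * P + R \<and> (R = 0 \<or> degree R < degree P)"
  using assms(3)
proof (induction "degree Q" arbitrary: Q rule: less_induct)
  case less
  consider "Q = 0 \<or> degree Q < degree P" | "Q \<noteq> 0" "degree Q = 0" "degree P = 0"
    | "degree P \<le> degree Q" "degree Q > 0"
    by linarith
  then show ?case
  proof cases
    case 1
    then show ?thesis using less.prems coeffs_in_0 by (intro exI[of _ 0] exI[of _ Q]) auto
  next
    \<comment> \<open>Cancelling the leading term of a constant does not lower its degree, so
      constants are divided directly.\<close>
    case 2
    obtain a b where ab: "Q = [:a:]" "P = [:b:]" using 2 by (metis degree_eq_zeroE)
    then have "a \<in> S" "b \<in> S" "b \<noteq> 0" using less.prems assms(1,2)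
      by (auto simp: coeffs_in_def dest: spec[of _ 0])
    then show ?thesis using ab S_mult S_inverse coeffs_in_0
      by (intro exI[of _ "[:a * inverse b:]"] exI[of _ 0]) (auto intro: coeffs_in_const)
  next
    case 3
    let ?c = "lead_coeff Q * inverse (lead_coeff P)"
    let ?M = "monom ?c (degree Q - degree P)"
    have M: "coeffs_in S ?M"
      using less.prems assms(1) by (intro coeffs_in_monom S_mult S_inverse) (auto simp: coeffs_in_def)
    define Q' where "Q' = Q - ?M * P"
    have Q': "coeffs_in S Q'" unfolding Q'_def by (intro coeffs_in_diff coeffs_in_mult M assms less.prems)
    have "degree Q' < degree Q"
    proof (rule degree_lessI)
      show "Q' \<noteq> 0 \<or> degree Q > 0" using 3 by simp
      show "\<forall>k\<ge>degree Q. coeff Q' k = 0"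
      proof (intro allI impI)
        fix k assume k: "degree Q \<le> k"
        have "coeff (?M * P) k = ?c * coeff P (k - (degree Q - degree P))"
          using k 3 by (simp add: coeff_monom_mult)
        also have "\<dots> = coeff Q k"
        proof (cases "k = degree Q")
          case True
          then show ?thesis using 3 assms(2) by simp
        next
          case False
          then have "degree Q < k" "degree P < k - (degree Q - degree P)" using k 3 by auto
          then show ?thesis by (simp add: coeff_eq_0)
        qed
        finally show "coeff Q' k = 0" by (simp add: Q'_def)
      qed
    qed
    from less.hyps[OF this Q'] obtain D R where "coeffs_in S D" "coeffs_in S R" "Q' = D * P + R"
      "R = 0 \<or> degree R < degree P" by blast
    then show ?thesis using M
      by (intro exI[of _ "D + ?M"] exI[of _ R]) (auto simp: Q'_def algebra_simps intro: coeffs_in_add)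
  qed
qed

text \<open>The hypothesis \<open>card\<close> says that the image of \<open>p\<close> has as many
  distinct roots as its degree. The minimal polynomial \<open>P\<close> of \<open>r\<close> divides
  \<open>p\<close>; if its image had no root, all these roots would belong to the image of the
  cofactor, which has smaller degree. A root \<open>r'\<close> of the image of \<open>P\<close> is
  then the value prescribed for \<open>r\<close>.\<close>

lemma extend_one:
  assumes p: "coeffs_in S p" "p \<noteq> 0" "poly p r = 0"
    and card: "card {x. poly (map_poly g p) x = 0} = degree p"
  shows "\<exists>T g'. is_subfield T \<and> hom_on T g' \<and> S \<subseteq> T \<and> r \<in> T \<and> (\<forall>x\<in>S. g' x = g x)"
proof -
  obtain P where P: "coeffs_in S P" "P \<noteq> 0" "poly P r = 0"
    and min: "\<And>Q. coeffs_in S Q \<Longrightarrow> Q \<noteq> 0 \<Longrightarrow> poly Q r = 0 \<Longrightarrow> degree P \<le> degree Q"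
    using ex_has_least_nat[of "\<lambda>P. coeffs_in S P \<and> P \<noteq> 0 \<and> poly P r = 0" p degree] p by blast
  have dP: "degree P > 0"
    using P by (metis degree_eq_zeroE gr0I pCons_0_0 poly_pCons mult_zero_right add.right_neutral poly_0)
  have dvd: "\<exists>D. coeffs_in S D \<and> Q = D * P" if Q: "coeffs_in S Q" "poly Q r = 0" for Q
  proof -
    obtain D R where DR: "coeffs_in S D" "coeffs_in S R" "Q = D * P + R" "R = 0 \<or> degree R < degree P"
      using coeffs_in_division[OF P(1,2) Q(1)] by blast
    then have "poly R r = 0" using Q P by simp
    then have "R = 0" using min[OF DR(2)] DR(4) by force
    then show ?thesis using DR by auto
  qed
  obtain D where D: "coeffs_in S D" "p = D * P" using dvd[OF p(1,3)] by blast
  have "\<exists>r'. poly (map_poly g P) r' = 0"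
  proof (rule ccontr)
    assume no: "\<nexists>r'. poly (map_poly g P) r' = 0"
    have "D \<noteq> 0" using D p by auto
    then have gD: "map_poly g D \<noteq> 0" using gmap_eq_0D[OF D(1)] by blast
    have "{x. poly (map_poly g p) x = 0} = {x. poly (map_poly g D) x = 0}"
      using no D P by (auto simp: gmap_mult)
    then have "card {x. poly (map_poly g p) x = 0} \<le> degree (map_poly g D)"
      using card_poly_roots_bound[OF gD] by simp
    also have "\<dots> = degree D" by (rule degree_gmap[OF D(1)])
    also have "\<dots> < degree p" using D \<open>D \<noteq> 0\<close> P dP by (simp add: degree_mult_eq)
    finally show False using card by simp
  qed
  then obtain r' where r': "poly (map_poly g P) r' = 0" by blast
  define T where "T = {poly Q r | Q. coeffs_in S Q}"
  \<comment> \<open>The choice of \<open>Q\<close> is harmless: two candidates differ by a multiple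
    of \<open>P\<close>, whose image vanishes at \<open>r'\<close>.\<close>
  define g' where "g' z = poly (map_poly g (SOME Q. coeffs_in S Q \<and> poly Q r = z)) r'" for z
  have g': "g' (poly Q r) = poly (map_poly g Q) r'" if Q: "coeffs_in S Q" for Q
  proof -
    define Q' where "Q' = (SOME Q'. coeffs_in S Q' \<and> poly Q' r = poly Q r)"
    have Q': "coeffs_in S Q'" "poly Q' r = poly Q r"
      using someI[of "\<lambda>Q'. coeffs_in S Q' \<and> poly Q' r = poly Q r" Q] Q by (auto simp: Q'_def)
    obtain D where D: "coeffs_in S D" "Q' - Q = D * P"
      using dvd[OF coeffs_in_diff[OF Q'(1) Q]] Q' by auto
    have "map_poly g Q' - map_poly g Q = map_poly g D * map_poly g P"
      using D P Q Q' by (metis gmap_diff gmap_mult)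
    then have "poly (map_poly g Q' - map_poly g Q) r' = 0" using r' by simp
    then show ?thesis by (simp add: g'_def Q'_def)
  qed
  have TI: "poly Q r \<in> T" if "coeffs_in S Q" for Q using that by (auto simp: T_def)
  have ST: "S \<subseteq> T" using TI[OF coeffs_in_const] by auto
  \<comment> \<open>Euclidean descent on the degree of \<open>Q\<close>: a large \<open>Q\<close> is
    reduced modulo \<open>P\<close>, a small one divides \<open>P\<close> with a remainder whose
    value at \<open>r\<close> is a multiple of that of \<open>Q\<close>. By minimality of
    \<open>P\<close> this value is nonzero.\<close>
  have inv: "\<exists>C. coeffs_in S C \<and> poly C r * poly Q r = 1" if "coeffs_in S Q" "poly Q r \<noteq> 0" for Q
    using that
  proof (induction "degree Q" arbitrary: Q rule: less_induct)
    case less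
    then have Q0: "Q \<noteq> 0" by auto
    consider "degree Q = 0" | "degree P \<le> degree Q" | "0 < degree Q" "degree Q < degree P" by linarith
    then show ?case
    proof cases
      case 1
      then obtain a where a: "Q = [:a:]" by (metis degree_eq_zeroE)
      then have "a \<in> S" using less.prems by (auto simp: coeffs_in_def dest: spec[of _ 0])
      then show ?thesis using a less.prems
        by (intro exI[of _ "[:inverse a:]"]) (auto intro: coeffs_in_const S_inverse)
    next
      case 2
      obtain D R where DR: "coeffs_in S D" "coeffs_in S R" "Q = D * P + R" "R = 0 \<or> degree R < degree P"
        using coeffs_in_division[OF P(1,2) less.prems(1)] by blast
      have R: "poly R r = poly Q r" using DR P by simp
      then have "R \<noteq> 0" using less.prems by auto
      then have "degree R < degree Q" using DR 2 by auto
      from less.hyps[OF this DR(2)] R less.prems show ?thesis by auto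
    next
      case 3
      obtain D R where DR: "coeffs_in S D" "coeffs_in S R" "P = D * Q + R" "R = 0 \<or> degree R < degree Q"
        using coeffs_in_division[OF less.prems(1) Q0 P(1)] by blast
      have e: "poly D r * poly Q r + poly R r = 0" using P(3) by (simp add: DR(3))
      show ?thesis
      proof (cases "poly R r = 0")
        case True
        then have "R = 0" using min[OF DR(2)] DR(4) 3 by force
        then have "P = D * Q" using DR by simp
        moreover from this have "D \<noteq> 0" using P by auto
        ultimately have "degree D < degree P" using 3 Q0 by (simp add: degree_mult_eq)
        moreover have "poly D r = 0" using e True less.prems by simp
        ultimately show ?thesis using min[OF DR(1) \<open>D \<noteq> 0\<close>] by simp
      next
        case False
        then have "degree R < degree Q" using DR by auto
        from less.hyps[OF this DR(2) False] obtain C where C: "coeffs_in S C" "poly C r * poly R r = 1"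
          by blast
        have "poly (- (C * D)) r * poly Q r = - (poly C r * (poly D r * poly Q r))" by simp
        also have "poly D r * poly Q r = - poly R r" using e by (simp add: eq_neg_iff_add_eq_0)
        finally show ?thesis using C DR
          by (intro exI[of _ "- (C * D)"]) (auto intro: coeffs_in_uminus coeffs_in_mult)
      qed
    qed
  qed
  have "is_subfield T" unfolding is_subfield_def
  proof (intro conjI ballI)
    show "0 \<in> T" "1 \<in> T" using ST S_0 S_1 by auto
  next
    fix x y assume "x \<in> T" "y \<in> T"
    then obtain Q R where "coeffs_in S Q" "coeffs_in S R" "x = poly Q r" "y = poly R r" by (auto simp: T_def)
    then show "x + y \<in> T" "x * y \<in> T"
      using TI[OF coeffs_in_add] TI[OF coeffs_in_mult] by (metis poly_add, metis poly_mult)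
  next
    fix x assume "x \<in> T"
    then obtain Q where Q: "coeffs_in S Q" "x = poly Q r" by (auto simp: T_def)
    then show "- x \<in> T" using TI[OF coeffs_in_uminus] by (metis poly_minus)
    show "inverse x \<in> T"
    proof (cases "x = 0")
      case False
      then obtain C where C: "coeffs_in S C" "poly C r * x = 1" using inv Q by blast
      then have "inverse x = poly C r" using False by (simp add: field_simps)
      then show ?thesis using TI C by simp
    qed (use ST S_0 in auto)
  qed
  moreover have "hom_on T g'" unfolding hom_on_def
  proof (intro conjI ballI)
    show "g' 1 = 1" using g'[OF coeffs_in_const[OF S_1]] by (simp add: gmap_const g_1)
  next
    fix x y assume "x \<in> T" "y \<in> T"
    then obtain Q R where QR: "coeffs_in S Q" "coeffs_in S R" "x = poly Q r" "y = poly R r" by (auto simp: T_def)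
    show "g' (x + y) = g' x + g' y"
      using g'[OF coeffs_in_add[OF QR(1,2)]] QR by (simp add: g' gmap_add)
    show "g' (x * y) = g' x * g' y"
      using g'[OF coeffs_in_mult[OF QR(1,2)]] QR by (simp add: g' gmap_mult)
  qed
  moreover have "r \<in> T" using TI[OF coeffs_in_monom[OF S_1, of 1]] by (simp add: poly_monom)
  moreover have "\<forall>x\<in>S. g' x = g x"
  proof
    fix x assume "x \<in> S"
    then show "g' x = g x" using g'[OF coeffs_in_const] by (simp add: gmap_const)
  qed
  ultimately show ?thesis using ST by blast
qed

end

text \<open>\<open>extend_one\<close> can be repeated: each extension agrees with \<open>g\<close>
  on the coefficients of \<open>p\<close>, so the image of \<open>p\<close> and its root count never
  change.\<close>

lemma extend_hom_roots:
  fixes S :: "'e::field set" and g :: "'e \<Rightarrow> 'f::field"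
  assumes "is_subfield S" "hom_on S g" "coeffs_in S p" "p \<noteq> 0"
    and "card {x. poly (map_poly g p) x = 0} = degree p"
    and "finite A" "\<And>r. r \<in> A \<Longrightarrow> poly p r = 0"
  shows "\<exists>T g'. is_subfield T \<and> hom_on T g' \<and> S \<subseteq> T \<and> A \<subseteq> T \<and> (\<forall>x\<in>S. g' x = g x)"
  using assms(6,7)
proof (induction A rule: finite_induct)
  case empty
  show ?case using assms by blast
next
  case (insert r A)
  then obtain T g' where T: "is_subfield T" "hom_on T g'" "S \<subseteq> T" "A \<subseteq> T" "\<forall>x\<in>S. g' x = g x"
    by auto
  interpret T: subfield_hom T g' by standard (use T in auto)
  interpret S: subfield_hom S g by standard (use assms in auto)
  have e: "map_poly g' p = map_poly g p"
    by (rule poly_eqI) (use T assms(3) in \<open>auto simp: coeffs_in_def\<close>)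
  have "\<exists>U f. is_subfield U \<and> hom_on U f \<and> T \<subseteq> U \<and> r \<in> U \<and> (\<forall>x\<in>T. f x = g' x)"
    by (rule T.extend_one[of p]) (use assms T insert e in \<open>auto simp: coeffs_in_def\<close>)
  then obtain U f where "is_subfield U" "hom_on U f" "T \<subseteq> U" "r \<in> U" "\<forall>x\<in>T. f x = g' x" by blast
  then show ?case using T by (intro exI[of _ U] exI[of _ f]) auto
qed

section \<open>Periods of squarefree polynomials over finite fields\<close>

lemma poly_bezout:
  fixes a b :: "'a::field poly"
  shows "\<exists>d u v. d = u * a + v * b \<and> d dvd a \<and> d dvd b"
\<comment> \<open>The measure puts \<open>b = 0\<close> strictly below the nonzero
  constants.\<close>
proof (induction "if b = 0 then 0 else Suc (degree b)" arbitrary: a b rule: less_induct)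
  case less
  show ?case
  proof (cases "b = 0")
    case True
    then show ?thesis by (intro exI[of _ a] exI[of _ 1] exI[of _ 0]) auto
  next
    case False
    have "(if a mod b = 0 then 0 else Suc (degree (a mod b))) < (if b = 0 then 0 else Suc (degree b))"
      using False degree_mod_less[of b a] by auto
    from less.hyps[OF this, of b] obtain d u v where
      d: "d = u * b + v * (a mod b)" "d dvd b" "d dvd a mod b" by blast
    have "d dvd a" using d(2,3) by (simp add: dvd_mod_iff)
    moreover have "d = v * a + (u - v * (a div b)) * b"
    proof -
      have "v * (a mod b) = v * a - v * (a div b) * b"
        by (simp add: minus_div_mult_eq_mod[symmetric] right_diff_distrib mult.assoc)
      then show ?thesis by (simp add: d(1) algebra_simps)
    qed
    ultimately show ?thesis using d(2) by blast
  qed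
qed

text \<open>Let \<open>d\<close> be the gcd of \<open>a\<close> and \<open>b\<close>, and
  \<open>a = d * e\<close>. Modulo \<open>a\<close>, \<open>d\<close> is a multiple of
  \<open>b\<close>, so \<open>a\<close>, and hence \<open>e\<close>, divides \<open>d ^ n\<close>.
  Squarefreeness makes \<open>d\<close> and \<open>e\<close> coprime, so \<open>e\<close> is a unit
  and \<open>a\<close> divides \<open>d\<close>.\<close>

lemma squarefree_poly_dvd_power:
  fixes a b :: "'a::field poly"
  assumes sq: "squarefree a" and dvd: "a dvd b ^ n"
  shows "a dvd b"
proof -
  obtain d u v where d: "d = u * a + v * b" "d dvd a" "d dvd b" using poly_bezout by blast
  obtain e where e: "a = d * e" using d(2) by (rule dvdE)
  obtain c s t where c: "c = s * d + t * e" "c dvd d" "c dvd e" using poly_bezout by blast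
  have "c ^ 2 dvd a" unfolding e power2_eq_square using c by (intro mult_dvd_mono)
  then have cu: "c dvd 1" using sq by (simp add: squarefree_def)
  have dvd_diff: "x - y dvd x ^ n - y ^ n" for x y :: "'a poly"
    by (subst power_diff_sumr2) simp
  have "d - v * b = a * u" by (simp add: d(1))
  then have "a dvd d ^ n - (v * b) ^ n"
    using dvd_trans[OF _ dvd_diff[of d "v * b"]] by simp
  then have "a dvd (d ^ n - (v * b) ^ n) + (v * b) ^ n"
    using dvd by (intro dvd_add) (simp_all add: power_mult_distrib)
  then have "a dvd d ^ n" by simp
  then have "e dvd d ^ n" using e dvd_mult_right[of d e] by simp
  moreover have "e dvd c ^ n - (s * d) ^ n"
  proof -
    have "c - s * d = e * t" by (simp add: c(1))
    then show ?thesis using dvd_trans[OF _ dvd_diff[of c "s * d"]] by simp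
  qed
  ultimately have "e dvd (c ^ n - (s * d) ^ n) + (s * d) ^ n"
    by (intro dvd_add) (simp_all add: power_mult_distrib)
  then have "e dvd c ^ n" by simp
  also have "c ^ n dvd 1" using dvd_power_same[OF cu, of n] by simp
  finally have "e dvd 1" .
  then have "a dvd d" using mult_dvd_mono[OF dvd_refl[of d], of e 1] e by simp
  then show ?thesis using d(3) by (rule dvd_trans)
qed

lemma dvd_linear_mult_cancel:
  fixes p :: "'a::field poly"
  assumes "p dvd [:- r, 1:] * c" "poly p r \<noteq> 0"
  shows "p dvd c"
proof -
  obtain e where e: "[:- r, 1:] * c = p * e" using assms(1) by (rule dvdE)
  have "poly (p * e) r = poly ([:- r, 1:] * c) r" by (simp only: e)
  then have "poly (p * e) r = 0" by simp
  then have "[:- r, 1:] dvd e" using assms(2) by (simp add: poly_eq_0_iff_dvd)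
  then obtain f where "e = [:- r, 1:] * f" by (rule dvdE)
  then have "[:- r, 1:] * c = [:- r, 1:] * (p * f)" using e by (simp only: mult_ac)
  then have "c = p * f" by (subst (asm) mult_left_cancel) simp_all
  then show ?thesis by simp
qed

lemma finite_degree_le: "finite {p :: 'a::{zero,finite} poly. degree p \<le> n}"
proof (rule finite_imageD)
  have "coeffs ` {p :: 'a poly. degree p \<le> n} \<subseteq> {xs. set xs \<subseteq> UNIV \<and> length xs \<le> Suc n}"
    by (auto simp: coeffs_def)
  then show "finite (coeffs ` {p :: 'a poly. degree p \<le> n})"
    by (rule finite_subset) (rule finite_lists_length_le, simp)
  show "inj_on coeffs {p :: 'a poly. degree p \<le> n}" by (simp add: inj_on_def coeffs_eq_iff)
qed

lemma frobenius_poly_diff: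
  fixes x y :: "'a::{field,finite} poly"
  shows "(x - y) ^ (CARD('a) ^ i) = x ^ (CARD('a) ^ i) - y ^ (CARD('a) ^ i)"
proof -
  interpret fq_algebra "\<lambda>c::'a. [:c:]" by standard auto
  show ?thesis by (rule frob_pow_diff)
qed

text \<open>Two of the residues of \<open>X^(q^i)\<close> modulo \<open>p\<close> coincide by the
  pigeonhole principle. The difference of these powers is a \<open>q^i\<close>-th power of
  \<open>X^(q^n) - X\<close>, and squarefreeness removes the outer exponent. Using only exponents
  \<open>q^i\<close> is what gives a period of the form \<open>q^n - 1\<close>.\<close>

lemma squarefree_poly_period:
  fixes p :: "'a::{field,finite} poly"
  assumes "squarefree p" "coeff p 0 \<noteq> 0"
  shows "\<exists>n. 0 < n \<and> p dvd monom 1 (CARD('a) ^ n - 1) - 1"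
proof -
  let ?q = "CARD('a)"
  define f where "f i = monom (1::'a) (?q ^ i) mod p" for i
  have "p \<noteq> 0" using assms(2) by auto
  then have "degree (f i) \<le> degree p" for i
    using degree_mod_less[of p "monom 1 (?q ^ i)"] by (auto simp: f_def)
  then have "range f \<subseteq> {r. degree r \<le> degree p}" by auto
  then have "finite (range f)" by (rule finite_subset) (rule finite_degree_le)
  then have "\<not> inj f" using infinite_UNIV_nat by (auto dest: finite_imageD)
  then obtain i j where ij: "i < j" "f i = f j" by (metis injI linorder_neqE_nat)
  define n where "n = j - i"
  have j: "j = n + i" "n > 0" using ij by (auto simp: n_def)
  define b where "b = monom (1::'a) (?q ^ n) - monom 1 1"
  have "p dvd monom 1 (?q ^ j) - monom 1 (?q ^ i)"
    using ij(2)[symmetric] by (simp add: f_def mod_eq_dvd_iff)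
  also have "monom 1 (?q ^ j) - monom 1 (?q ^ i) = b ^ (?q ^ i)"
    by (simp add: b_def frobenius_poly_diff monom_power j power_add)
  finally have "p dvd b" using assms(1) squarefree_poly_dvd_power by blast
  moreover have "b = [:- 0, 1:] * (monom 1 (?q ^ n - 1) - 1)"
  proof -
    have "monom (1::'a) (?q ^ n) = [:0, 1:] * monom 1 (?q ^ n - 1)"
      using monom_Suc[of "1::'a" "?q ^ n - 1"] by simp
    moreover have "monom (1::'a) 1 = [:0, 1:]" by (simp add: monom_altdef)
    ultimately show ?thesis by (simp add: b_def right_diff_distrib)
  qed
  ultimately have "p dvd [:- 0, 1:] * (monom 1 (?q ^ n - 1) - 1)" by (simp only:)
  moreover have "poly p 0 \<noteq> 0" using assms(2) by (simp add: poly_0_coeff_0)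
  ultimately have "p dvd monom 1 (?q ^ n - 1) - 1" by (rule dvd_linear_mult_cancel)
  then show ?thesis using j(2) by (intro exI[of _ n] conjI)
qed

lemma of_nat_card_eq_0: "of_nat CARD('a) = (0::'a::{field,finite})"
  using of_nat_card_choose_eq_0[where 'a='a, of 1] one_less_card_field[where 'a='a] by simp

text \<open>The exponent is \<open>q ^ n - 1\<close>, prime to the characteristic, so \<open>1\<close> is a simple root of \<open>X ^ e - 1\<close>.\<close>

lemma transvection_exponent:
  fixes M1 :: "'a::{field,finite} poly"
  assumes "squarefree M1" "coeff M1 0 \<noteq> 0" "poly M1 1 \<noteq> 0"
  defines "M \<equiv> [:-1, 1:] ^ 2 * M1"
  shows "\<exists>e. M dvd [:-1, 1:] * (monom 1 e - 1) \<and> \<not> M dvd monom 1 e - 1"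
proof -
  obtain n where n: "0 < n" "M1 dvd monom 1 (CARD('a) ^ n - 1) - 1"
    using squarefree_poly_period[OF assms(1,2)] by blast
  define e where "e = CARD('a) ^ n - 1"
  define F where "F = monom (1::'a) e - 1"
  have "poly F 1 = 0" by (simp add: F_def poly_monom)
  then have "[:-1, 1:] dvd F" by (simp add: poly_eq_0_iff_dvd)
  then obtain H where H: "F = [:-1, 1:] * H" by (rule dvdE)
  have "M1 dvd [:-1, 1:] * H" using n(2) unfolding H[symmetric] F_def e_def .
  \<comment> \<open>\<open>M1\<close> is prime to \<open>X - 1\<close>, so it divides
    \<open>H\<close>; the square in \<open>M\<close> is supplied by
    \<open>(X - 1) F = (X - 1)^2 H\<close>.\<close>
  then have "M1 dvd H" using assms(3) by (rule dvd_linear_mult_cancel)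
  then have "[:-1, 1:] ^ 2 * M1 dvd [:-1, 1:] ^ 2 * H" by (intro mult_dvd_mono dvd_refl)
  then have "M dvd [:-1, 1:] * F" by (simp only: M_def H power2_eq_square mult.assoc)
  moreover have "\<not> M dvd F"
  proof
    assume "M dvd F"
    then have "[:-1, 1:] ^ 2 dvd F" unfolding M_def by (rule dvd_mult_left)
    then obtain u where "F = [:-1, 1:] * ([:-1, 1:] * u)"
      unfolding power2_eq_square mult.assoc by (metis dvdE mult.assoc)
    then have "pderiv F = [:-1, 1:] * pderiv ([:-1, 1:] * u) + ([:-1, 1:] * u) * pderiv [:-1, 1:]"
      by (simp only: pderiv_mult)
    then have "poly (pderiv F) 1 = 0"
      by (simp only: poly_add poly_mult) simp
    moreover have "poly (pderiv F) 1 = of_nat e" by (simp add: F_def pderiv_diff pderiv_monom poly_monom)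
    moreover have "of_nat e = (-1::'a)"
      using n(1) by (simp add: e_def of_nat_diff of_nat_card_eq_0 zero_power)
    ultimately show False by simp
  qed
  ultimately show ?thesis unfolding F_def by (intro exI[of _ e] conjI)
qed

section \<open>Power series roots\<close>

text \<open>Split off one root \<open>a\<close>, leaving \<open>r\<close>. The derivative of
  \<open>p\<close> at \<open>a\<close> is the value of \<open>r\<close> there, so \<open>a\<close>
  is not a root of \<open>r\<close>, and \<open>r\<close> inherits the simplicity of its
  roots.\<close>

lemma card_roots_eq_degree:
  fixes p :: "'k::alg_closed_field poly"
  assumes "p \<noteq> 0" "\<And>x. poly p x = 0 \<Longrightarrow> poly (pderiv p) x \<noteq> 0"
  shows "card {x. poly p x = 0} = degree p"
  using assms
proof (induction "degree p" arbitrary: p)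
  case 0
  then obtain c where "p = [:c:]" "c \<noteq> 0" by (metis degree_eq_zeroE pCons_0_0)
  then show ?case by simp
next
  case (Suc n)
  then obtain a where a: "poly p a = 0" using alg_closed_imp_poly_has_root[of p] by auto
  then have "[:- a, 1:] dvd p" by (simp add: poly_eq_0_iff_dvd)
  then obtain r where r: "p = [:- a, 1:] * r" by (rule dvdE)
  have r0: "r \<noteq> 0" using Suc.prems r by auto
  have "degree p = Suc (degree r)" unfolding r using r0 by (subst degree_mult_eq) auto
  then have n: "n = degree r" using Suc.hyps by simp
  have d: "poly (pderiv p) x = (x - a) * poly (pderiv r) x + poly r x" for x
    unfolding r pderiv_mult by (simp add: pderiv_pCons algebra_simps)
  have ra: "poly r a \<noteq> 0" using Suc.prems(2)[OF a] d[of a] by simp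
  have e: "poly p x = (x - a) * poly r x" for x unfolding r by (simp add: algebra_simps)
  have "card {x. poly r x = 0} = degree r"
  proof (rule Suc.hyps(1)[OF n r0])
    fix x assume x: "poly r x = 0"
    then have "poly p x = 0" by (simp add: e)
    from Suc.prems(2)[OF this] show "poly (pderiv r) x \<noteq> 0" using d[of x] x by auto
  qed
  moreover have "{x. poly p x = 0} = insert a {x. poly r x = 0}" by (auto simp: e)
  moreover have "finite {x. poly r x = 0}" using r0 by (rule poly_roots_finite)
  ultimately show ?case using ra Suc.hyps(2) n by simp
qed

text \<open>A coefficient of a power series root may depend on any earlier one. The hypothesis says
  that \<open>H f n\<close> reads \<open>f\<close> only below \<open>n\<close>, so well-founded
  recursion applies.\<close>

lemma ex_course_of_values:
  fixes H :: "(nat \<Rightarrow> 'k) \<Rightarrow> nat \<Rightarrow> 'k"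
  assumes "\<And>f g n. (\<And>j. j < n \<Longrightarrow> f j = g j) \<Longrightarrow> H f n = H g n"
  shows "\<exists>x. \<forall>n. x n = H x n"
proof -
  have "adm_wf less_than H" unfolding adm_wf_def using assms by (metis less_than_iff)
  then have "wfrec less_than H = H (wfrec less_than H)" by (intro wfrec_fixpoint wf_less_than)
  then show ?thesis by metis
qed

text \<open>Raising to the power \<open>Q\<close> acts term by term, but additivity covers only
  finite sums. So \<open>f\<close> is cut after the \<open>n\<close>-th term, and the tail
  \<open>d\<close> contributes nothing up to there since \<open>d ^ Q\<close> is a multiple of
  \<open>d\<close>.\<close>

lemma (in fq_hom) fps_frob_nth:
  "fps_nth ((f :: 'b fps) ^ (CARD('a) ^ i)) n =
     (if CARD('a) ^ i dvd n then fps_nth f (n div CARD('a) ^ i) ^ (CARD('a) ^ i) else 0)"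
proof -
  interpret F: fq_algebra "\<lambda>c. fps_const (h c)"
    by standard (simp_all add: hom_add hom_mult)
  let ?Q = "CARD('a) ^ i"
  define s where "s = (\<Sum>j\<le>n. fps_const (fps_nth f j) * fps_X ^ j)"
  define d where "d = f - s"
  have Q: "?Q > 0" by simp
  have "fps_nth d j = 0" if "j \<le> n" for j
  proof -
    have "fps_nth s j = (\<Sum>k\<le>n. if j = k then fps_nth f k else 0)"
      unfolding s_def fps_sum_nth by (rule sum.cong) auto
    then show ?thesis using that by (simp add: d_def)
  qed
  then have "fps_nth (d * d ^ (?Q - 1)) n = 0" by (simp add: fps_mult_nth)
  then have d: "fps_nth (d ^ ?Q) n = 0" using Q by (metis power_eq_if less_not_refl)
  have "f ^ ?Q = (s + d) ^ ?Q" by (simp add: d_def)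
  also have "\<dots> = s ^ ?Q + d ^ ?Q" by (rule F.frob_pow_add)
  also have "s ^ ?Q = (\<Sum>j\<le>n. fps_const (fps_nth f j ^ ?Q) * fps_X ^ (j * ?Q))"
    unfolding s_def F.frob_pow_sum
    by (simp add: power_mult_distrib fps_const_power power_mult)
  finally have "fps_nth (f ^ ?Q) n = (\<Sum>j\<le>n. if n = j * ?Q then fps_nth f j ^ ?Q else 0)"
    using d by (simp add: fps_sum_nth if_distrib cong: if_cong)
  also have "\<dots> = (if ?Q dvd n then fps_nth f (n div ?Q) ^ ?Q else 0)"
  proof (cases "?Q dvd n")
    case True
    then have "(\<Sum>j\<le>n. if n = j * ?Q then fps_nth f j ^ ?Q else 0) =
      (\<Sum>j\<le>n. if j = n div ?Q then fps_nth f j ^ ?Q else 0)"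
      by (intro sum.cong refl if_cong) (use Q in auto)
    then show ?thesis using True by simp
  next
    case False
    then have "n \<noteq> j * ?Q" for j by auto
    then show ?thesis using False by simp
  qed
  finally show ?thesis .
qed

section \<open>Roots of the reduction and their power series lifts\<close>

locale laurent_roots = fq_hom h for h :: "'a::{field,finite} \<Rightarrow> 'k::alg_closed_field" +
  fixes M :: "'a poly" and m :: nat
  assumes m: "1 \<le> m" and deg_M: "degree M = 2 * m" and M_0: "coeff M 0 = 1"
begin

text \<open>The roots in \<open>'k\<close> of \<Phi>, which is the reduction of L at t = 0.\<close>

definition redroots :: "'k set" where "redroots = {a. qact M a = 0}"

lemma M_nz: "M \<noteq> 0" using M_0 by auto

lemma card_redroots: "card redroots = CARD('a) ^ (2 * m)"
proof -
  define p where "p = (\<Sum>i\<le>2 * m. monom (h (coeff M i)) (CARD('a) ^ i))"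
  have ev: "poly p x = qact M x" for x
    by (simp add: p_def poly_sum poly_monom qact_def deg_M)
  have co: "coeff p (CARD('a) ^ (2 * m)) = h (coeff M (2 * m))"
  proof -
    have "coeff p (CARD('a) ^ (2 * m)) = (\<Sum>i\<le>2 * m. if i = 2 * m then h (coeff M i) else 0)"
      unfolding p_def coeff_sum
      by (rule sum.cong) (use one_less_card_field[where 'a='a] in \<open>auto simp: power_inject_exp\<close>)
    then show ?thesis by simp
  qed
  have "coeff M (2 * m) \<noteq> 0" using M_nz deg_M by (metis leading_coeff_0_iff)
  then have co0: "coeff p (CARD('a) ^ (2 * m)) \<noteq> 0" using co by simp
  have "degree p \<le> CARD('a) ^ (2 * m)" unfolding p_def
    by (rule degree_sum_le)
       (use one_less_card_field[where 'a='a] in \<open>auto intro!: order.trans[OF degree_monom_le] power_increasing\<close>)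
  then have deg: "degree p = CARD('a) ^ (2 * m)" using co0 le_degree by (metis le_antisym)
  have q0: "of_nat CARD('a) = (0::'k)"
    using of_nat_card_eq_0[where 'a='a] by (metis hom_of_nat hom_zero)
  have "poly (pderiv p) x = (\<Sum>i\<le>2 * m. if i = 0 then 1 else 0)" for x
    unfolding p_def pderiv_sum poly_sum
    by (rule sum.cong) (auto simp: pderiv_monom poly_monom q0 M_0 zero_power)
  \<comment> \<open>Each \<open>q^i\<close> with \<open>i > 0\<close> is zero in \<open>'k\<close>,
    so only the term with \<open>i = 0\<close> survives.\<close>
  then have "poly (pderiv p) x \<noteq> 0" for x by simp
  then have "card {x. poly p x = 0} = degree p"
    using co0 by (intro card_roots_eq_degree) auto
  then show ?thesis by (simp add: redroots_def ev deg)
qed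

definition L_fls :: "'k fls poly" where
  "L_fls = (\<Sum>i\<le>2 * m. monom (fls_const (h (coeff M i))) (CARD('a) ^ i)) + monom fls_X (CARD('a) ^ m)"

lemma degree_L_fls: "degree L_fls = CARD('a) ^ (2 * m)"
  and L_fls_nz: "L_fls \<noteq> 0"
proof -
  let ?d = "CARD('a) ^ (2 * m)"
  have lt: "CARD('a) ^ m < ?d" using m by (intro card_pow_strict_mono) auto
  have "coeff L_fls ?d = (\<Sum>i\<le>2 * m. if i = 2 * m then fls_const (h (coeff M i)) else 0)"
    unfolding L_fls_def coeff_add coeff_sum using lt m
    by (auto intro!: sum.cong simp: power_inject_exp[OF one_less_card_field[where 'a='a]]
        simp del: sum.delta sum.delta')
  then have "coeff L_fls ?d = fls_const (h (coeff M (2 * m)))" by simp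
  moreover have "coeff M (2 * m) \<noteq> 0" using M_nz deg_M by (metis leading_coeff_0_iff)
  ultimately have co: "coeff L_fls ?d \<noteq> 0" by simp
  then show "L_fls \<noteq> 0" by auto
  have "degree L_fls \<le> ?d" unfolding L_fls_def
    by (intro degree_add_le degree_sum_le)
       (use one_less_card_field[where 'a='a] lt in \<open>auto intro!: order.trans[OF degree_monom_le] power_increasing\<close>)
  then show "degree L_fls = ?d" using co le_degree by (metis le_antisym)
qed

text \<open>For \<open>n > 0\<close> the \<open>n\<close>-th coefficient of the equation \<open>L(x) = 0\<close> expresses \<open>x\<^sub>n\<close>
  through earlier coefficients, because the linear term of \<open>L\<close> is \<open>x\<close> itself.\<close>

lemma ex_power_series_root:
  assumes "a \<in> redroots"
  shows "\<exists>f. fps_nth f 0 = a \<and> poly L_fls (fps_to_fls f) = 0"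
proof -
  \<comment> \<open>\<open>P x i n\<close> is the \<open>n\<close>-th coefficient of the
    \<open>q^i\<close>-th power of the series with coefficients \<open>x\<close>. The index
    \<open>n - 1\<close> in \<open>H\<close> below comes from the factor t in L.\<close>
  define P where "P x i n = (if CARD('a) ^ i dvd n then x (n div CARD('a) ^ i) ^ (CARD('a) ^ i) else 0)"
    for x :: "nat \<Rightarrow> 'k" and i n
  define H where "H x n = (if n = 0 then a else
    - (\<Sum>i\<in>{1..2 * m}. h (coeff M i) * P x i n) - P x m (n - 1))" for x n
  have q: "1 < CARD('a)" by (rule one_less_card_field)
  have "\<exists>x. \<forall>n. x n = H x n"
  proof (rule ex_course_of_values)
    fix f g :: "nat \<Rightarrow> 'k" and n
    assume fg: "\<And>j. j < n \<Longrightarrow> f j = g j"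
    show "H f n = H g n"
    proof (cases "n = 0")
      case False
      have "n div CARD('a) ^ i < n" if "i \<ge> 1" for i
        using False q that by (intro div_less_dividend one_less_power) auto
      then have "P f i n = P g i n" if "i \<ge> 1" for i using that fg by (simp add: P_def)
      moreover have "(n - 1) div CARD('a) ^ m < n"
        using False by (metis div_le_dividend diff_less le_less_trans less_one not_gr_zero)
      then have "P f m (n - 1) = P g m (n - 1)" using fg by (simp add: P_def)
      ultimately show ?thesis by (simp add: H_def)
    qed (simp add: H_def)
  qed
  then obtain x where x: "\<And>n. x n = H x n" by blast
  define f where "f = Abs_fps x"
  have pw: "fps_nth (f ^ (CARD('a) ^ i)) n = P x i n" for i n
    by (simp add: fps_frob_nth P_def f_def)
  have "(\<Sum>i\<le>2 * m. fps_const (h (coeff M i)) * f ^ (CARD('a) ^ i)) + fps_X * f ^ (CARD('a) ^ m) = 0"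
  proof (rule fps_ext)
    fix n
    have "fps_nth ((\<Sum>i\<le>2 * m. fps_const (h (coeff M i)) * f ^ (CARD('a) ^ i)) + fps_X * f ^ (CARD('a) ^ m)) n
      = (\<Sum>i\<le>2 * m. h (coeff M i) * P x i n) + (if n = 0 then 0 else P x m (n - 1))"
      by (simp add: fps_sum_nth pw)
    also have "\<dots> = 0"
    proof (cases "n = 0")
      case True
      have "x 0 = a" using x[of 0] by (simp add: H_def)
      then have "(\<Sum>i\<le>2 * m. h (coeff M i) * P x i n) = qact M a"
        by (simp add: P_def True qact_def deg_M)
      then show ?thesis using True assms by (simp add: redroots_def)
    next
      case False
      have "{..2 * m} = insert 0 {1..2 * m}" by auto
      then have "(\<Sum>i\<le>2 * m. h (coeff M i) * P x i n) = x n + (\<Sum>i\<in>{1..2 * m}. h (coeff M i) * P x i n)"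
        by (simp add: M_0 P_def)
      moreover have "x n = - (\<Sum>i\<in>{1..2 * m}. h (coeff M i) * P x i n) - P x m (n - 1)"
        using x[of n] False by (simp add: H_def)
      ultimately show ?thesis using False by simp
    qed
    finally show "fps_nth ((\<Sum>i\<le>2 * m. fps_const (h (coeff M i)) * f ^ (CARD('a) ^ i)) + fps_X * f ^ (CARD('a) ^ m)) n
      = fps_nth 0 n" by simp
  qed
  then have "fps_to_fls ((\<Sum>i\<le>2 * m. fps_const (h (coeff M i)) * f ^ (CARD('a) ^ i)) + fps_X * f ^ (CARD('a) ^ m)) = 0"
    by simp
  moreover have "fps_to_fls (\<Sum>i\<in>A. g i) = (\<Sum>i\<in>A. fps_to_fls (g i))" for A and g :: "nat \<Rightarrow> 'k fps"
    by (induction A rule: infinite_finite_induct) auto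
  ultimately have "poly L_fls (fps_to_fls f) = 0"
    by (simp add: L_fls_def poly_sum poly_monom fls_times_fps_to_fls fps_to_fls_power)
  moreover have "fps_nth f 0 = a" using x[of 0] by (simp add: f_def H_def)
  ultimately show ?thesis by blast
qed

text \<open>The lifts are distinct because their constant terms are, and there are as many of them
  as the degree of L allows. Hence they are all the roots.\<close>

lemma L_fls_roots:
  shows "card {x. poly L_fls x = 0} = degree L_fls"
    and "bij_betw (\<lambda>x. fls_nth x 0) {x. poly L_fls x = 0} redroots"
    and "{x. poly L_fls x = 0} \<subseteq> range fps_to_fls"
proof -
  obtain \<xi> where \<xi>: "\<And>a. a \<in> redroots \<Longrightarrow> fps_nth (\<xi> a) 0 = a \<and> poly L_fls (fps_to_fls (\<xi> a)) = 0"
    using ex_power_series_root by metis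
  let ?R = "{x. poly L_fls x = 0}" and ?Y = "\<lambda>a. fps_to_fls (\<xi> a)"
  have inj: "inj_on ?Y redroots" by (rule inj_onI) (metis \<xi> fps_to_fls_eq_iff)
  have "card (?Y ` redroots) = degree L_fls"
    using card_image[OF inj] by (simp add: card_redroots degree_L_fls)
  moreover have sub: "?Y ` redroots \<subseteq> ?R" using \<xi> by auto
  moreover have fin: "finite ?R" using L_fls_nz by (rule poly_roots_finite)
  moreover have "card ?R \<le> degree L_fls" using L_fls_nz by (rule card_poly_roots_bound)
  ultimately have eq: "?Y ` redroots = ?R" by (metis card_seteq)
  then show "?R \<subseteq> range fps_to_fls" by auto
  show "card ?R = degree L_fls" using eq \<open>card (?Y ` redroots) = degree L_fls\<close> by simp
  show "bij_betw (\<lambda>x. fls_nth x 0) ?R redroots"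
    by (rule bij_betwI[of _ _ _ ?Y]) (use \<xi> sub in \<open>auto simp: eq[symmetric]\<close>)
qed

end

section \<open>The coefficientwise Frobenius of Laurent series\<close>

text \<open>Unlike in \<open>f ^ q\<close>, the variable stays fixed: for
  \<open>q = CARD('a)\<close> this extends the Frobenius of the coefficient field by t \<mapsto>
  t.\<close>

definition fls_frob :: "nat \<Rightarrow> 'k::field fls \<Rightarrow> 'k fls" where
  "fls_frob q f = Abs_fls (\<lambda>n. fls_nth f n ^ q)"

lemma fls_frob_nth:
  assumes "0 < q"
  shows "fls_nth (fls_frob q f) n = fls_nth f n ^ q"
  unfolding fls_frob_def
  by (rule nth_Abs_fls_lower_bound[of "fls_subdegree f"]) (use assms in \<open>auto simp: zero_power\<close>)

text \<open>Coefficients of a product of Laurent series are sums over ranges given by the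
  subdegrees, so \<open>fls_frob_mult\<close> requires these to be preserved.\<close>

lemma fls_frob_subdegree:
  assumes "0 < q"
  shows "fls_subdegree (fls_frob q f) = fls_subdegree f"
proof (cases "f = 0")
  case True
  have "fls_frob q 0 = (0::'a fls)" by (rule fls_eqI) (use assms in \<open>simp add: fls_frob_nth zero_power\<close>)
  then show ?thesis using True by simp
next
  case False
  then show ?thesis
    by (intro fls_subdegree_eqI) (use assms in \<open>auto simp: fls_frob_nth zero_power\<close>)
qed

context fq_hom
begin

lemma fls_frob_nth': "fls_nth (fls_frob CARD('a) (f::'b fls)) n = fls_nth f n ^ CARD('a)"
  by (simp add: fls_frob_nth)

lemma fls_frob_add: "fls_frob CARD('a) (f + g :: 'b fls) = fls_frob CARD('a) f + fls_frob CARD('a) g"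
  by (rule fls_eqI) (simp add: fls_frob_nth' frob_add)

lemma fls_frob_mult: "fls_frob CARD('a) (f * g :: 'b fls) = fls_frob CARD('a) f * fls_frob CARD('a) g"
  by (rule fls_eqI)
     (simp add: fls_frob_nth' fls_times_nth(2) frob_sum power_mult_distrib fls_frob_subdegree)

lemma fls_frob_1: "fls_frob CARD('a) (1 :: 'b fls) = 1"
  by (rule fls_eqI) (simp add: fls_frob_nth' frob_zero)

lemma fls_frob_field_hom: "field_hom (fls_frob CARD('a) :: 'b fls \<Rightarrow> 'b fls)"
proof
  show "fls_frob CARD('a) 0 = (0 :: 'b fls)"
    by (rule fls_eqI) (simp add: fls_frob_nth' frob_zero)
qed (simp_all add: fls_frob_add fls_frob_mult fls_frob_1)

lemma fls_frob_const: "fls_frob CARD('a) (fls_const (h c)) = fls_const (h c)"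
  by (rule fls_eqI) (simp add: fls_frob_nth' frob_zero frob_h)

end

text \<open>If \<open>z\<close> had a pole then \<open>1/z\<close> would be a power series, and dividing the integral equation of
  degree \<open>n\<close> by \<open>z ^ (n - 1)\<close> would express \<open>z\<close> as a polynomial in \<open>1/z\<close>.\<close>

lemma fls_integral_imp_fps:
  fixes z :: "'k::field fls"
  assumes "lead_coeff p = 1" "\<And>i. coeff p i \<in> range fps_to_fls" "poly p z = 0"
  shows "z \<in> range fps_to_fls"
proof (cases "fls_subdegree z \<ge> 0")
  case True
  then show ?thesis by (metis fls_regpart_to_fls_trivial rangeI)
next
  case False
  define y where "y = inverse z"
  have z0: "z \<noteq> 0" using False by auto
  have "fls_subdegree y \<ge> 0" using False by (simp add: y_def)
  then have y: "y \<in> range fps_to_fls" by (metis fls_regpart_to_fls_trivial rangeI)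
  have O_mult: "u * v \<in> range fps_to_fls" if "u \<in> range fps_to_fls" "v \<in> range fps_to_fls" for u v :: "'k fls"
    using that by (auto simp: fls_times_fps_to_fls[symmetric])
  have O_sum: "(\<Sum>i\<in>A. u i) \<in> range fps_to_fls" if "\<And>i. i \<in> A \<Longrightarrow> u i \<in> range fps_to_fls"
    for A and u :: "nat \<Rightarrow> 'k fls"
    using that
  proof (induction A rule: infinite_finite_induct)
    case (insert x A)
    then have "u x \<in> range fps_to_fls" "sum u A \<in> range fps_to_fls" by auto
    then obtain f g where "u x = fps_to_fls f" "sum u A = fps_to_fls g" by auto
    then have "sum u (insert x A) = fps_to_fls (f + g)" using insert by simp
    then show ?case by blast
  qed (auto intro: range_eqI[of _ _ 0])
  have O_uminus: "- u \<in> range fps_to_fls" if "u \<in> range fps_to_fls" for u :: "'k fls"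
    using that by (auto simp: fps_to_fls_uminus[symmetric] simp del: fps_to_fls_uminus)
  have O_pow: "y ^ i \<in> range fps_to_fls" for i
    using y by (auto simp: fps_to_fls_power[symmetric])
  \<comment> \<open>The degree is \<open>Suc n\<close> here, so the equation is divided by
    \<open>z ^ n\<close>.\<close>
  obtain n where n: "degree p = Suc n"
    using assms(1,3) by (cases "degree p") (auto elim!: degree_eq_zeroE)
  have "0 = y ^ n * poly p z" using assms by simp
  also have "\<dots> = (\<Sum>i\<le>Suc n. coeff p i * (y ^ n * z ^ i))"
    by (simp add: poly_altdef n sum_distrib_left mult_ac del: sum.atMost_Suc)
  also have "\<dots> = (\<Sum>i\<le>n. coeff p i * (y ^ n * z ^ i)) + y ^ n * z ^ Suc n"
    using assms(1) n by simp
  also have "y ^ n * z ^ Suc n = z" using z0 by (simp add: y_def field_simps)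
  also have "(\<Sum>i\<le>n. coeff p i * (y ^ n * z ^ i)) = (\<Sum>i\<le>n. coeff p i * y ^ (n - i))"
  proof (rule sum.cong)
    fix i assume "i \<in> {..n}"
    then have "y ^ n = y ^ (n - i) * y ^ i" by (simp flip: power_add)
    then have "y ^ n * z ^ i = y ^ (n - i) * (y * z) ^ i" by (simp add: power_mult_distrib mult.assoc)
    then show "coeff p i * (y ^ n * z ^ i) = coeff p i * y ^ (n - i)" using z0 by (simp add: y_def)
  qed simp
  finally have "z = - (\<Sum>i\<le>n. coeff p i * y ^ (n - i))"
    by (simp add: eq_neg_iff_add_eq_0 add.commute)
  also have "\<dots> \<in> range fps_to_fls" by (intro O_uminus O_sum O_mult assms(2) O_pow)
  finally show ?thesis .
qed

section \<open>The invariant alternating form\<close>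

lemma sum_symmetric_split:
  fixes F :: "nat \<Rightarrow> 'b::comm_ring_1"
  shows "(\<Sum>k\<le>2 * m. F k) = F m + (\<Sum>i\<in>{1..m}. F (m + i) + F (m - i))"
proof -
  have "(\<Sum>k\<in>{m - n..m + n}. F k) = F m + (\<Sum>i\<in>{1..n}. F (m + i) + F (m - i))" if "n \<le> m" for n
    using that
  proof (induction n)
    case (Suc n)
    have "{m - Suc n..m + Suc n} = insert (m - Suc n) (insert (m + Suc n) {m - n..m + n})"
      using Suc.prems by auto
    moreover have "m - Suc n \<notin> {m - n..m + n}" "m + Suc n \<notin> {m - n..m + n}" "m - Suc n \<noteq> m + Suc n"
      using Suc.prems by auto
    ultimately show ?case using Suc by (simp add: algebra_simps)
  qed simp
  from this[of m] show ?thesis by (simp add: mult_2 atLeast0AtMost)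
qed

context fq_hom
begin

definition brk :: "'b \<Rightarrow> 'b \<Rightarrow> nat \<Rightarrow> nat \<Rightarrow> 'b" where
  "brk x y a b = x ^ (CARD('a) ^ a) * y ^ (CARD('a) ^ b) - x ^ (CARD('a) ^ b) * y ^ (CARD('a) ^ a)"

text \<open>Multiplying L(y) by \<open>x^(q^m)\<close>, L(x) by \<open>y^(q^m)\<close> and
  subtracting cancels t and the middle coefficient. By the palindromic shape what remains is a
  combination of the differences \<open>brk x y m (m + i) - brk x y (m - i) m\<close>. The inner sum
  over \<open>j\<close> is a solution \<open>Z\<close> of \<open>Z^q - Z\<close> equal to such a
  difference.\<close>

definition wform :: "'a poly \<Rightarrow> nat \<Rightarrow> 'b \<Rightarrow> 'b \<Rightarrow> 'b" where
  "wform M m x y = (\<Sum>i\<in>{1..m}. \<Sum>j<i. h (coeff M (m + i)) * brk x y (m - i + j) (m + j))"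

lemma brk_frob: "brk x y a b ^ CARD('a) = brk x y (Suc a) (Suc b)"
  by (simp add: brk_def frob_diff power_mult_distrib mult.commute[of "CARD('a)"] flip: power_mult)

lemma wform_add_left: "wform M m (x + x') y = wform M m x y + wform M m x' y"
  by (simp add: wform_def brk_def frob_pow_add algebra_simps sum.distrib sum_subtractf)

lemma wform_skew: "wform M m x y = - wform M m y x"
  by (simp add: wform_def brk_def algebra_simps flip: sum_negf)

lemma wform_add_right: "wform M m x (y + y') = wform M m x y + wform M m x y'"
  by (subst (1 2 3) wform_skew) (simp add: wform_add_left)

lemma wform_scale_left: "wform M m (h c * x) y = h c * wform M m x y"
  by (simp add: wform_def brk_def power_mult_distrib frob_pow_h sum_distrib_left algebra_simps)

lemma wform_scale_right: "wform M m x (h c * y) = h c * wform M m x y"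
  by (subst (1 2) wform_skew) (simp add: wform_scale_left)

lemma wform_self: "wform M m x x = 0"
  by (simp add: wform_def brk_def)

text \<open>The form is a polynomial expression over F_q; invariance under the Galois group follows
  from this.\<close>

lemma wform_hom:
  assumes "\<And>x y. s (x + y) = s x + s y" "\<And>x y. s (x * y) = s x * s y" "\<And>c. s (h c) = h c"
  shows "s (wform M m x y) = wform M m (s x) (s y)"
proof -
  have s0: "s 0 = 0" using assms(3)[of 0] by simp
  have s1: "s 1 = 1" using assms(3)[of 1] by simp
  have sm: "s (a - b) = s a - s b" for a b using assms(1)[of "a - b" b] by simp
  have ss: "s (\<Sum>i\<in>A. f i) = (\<Sum>i\<in>A. s (f i))" for A and f :: "nat \<Rightarrow> 'b"
    by (induction A rule: infinite_finite_induct) (auto simp: s0 assms(1))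
  have sp: "s (a ^ n) = s a ^ n" for a n by (induction n) (auto simp: s1 assms(2))
  show ?thesis by (simp add: wform_def brk_def ss assms(2,3) sm sp)
qed

text \<open>The sums over \<open>j\<close> telescope, and \<open>W\<^sup>q - W\<close> becomes \<open>L(y) x\<^sup>e - L(x) y\<^sup>e\<close> with \<open>e = q\<^sup>m\<close>.\<close>

lemma wform_frob:
  assumes deg: "degree M = 2 * m" and sym: "\<And>i. i \<le> 2 * m \<Longrightarrow> coeff M i = coeff M (2 * m - i)"
    and x: "qact M x + t * x ^ (CARD('a) ^ m) = 0" and y: "qact M y + t * y ^ (CARD('a) ^ m) = 0"
  shows "wform M m x y ^ CARD('a) = wform M m x y"
proof -
  let ?d = "\<lambda>i. h (coeff M (m + i))"
  let ?z = "\<lambda>z k. z ^ (CARD('a) ^ k) :: 'b"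
  have q: "qact M z = h (coeff M m) * ?z z m + (\<Sum>i\<in>{1..m}. ?d i * (?z z (m + i) + ?z z (m - i)))" for z
  proof -
    have "qact M z = h (coeff M m) * ?z z m +
      (\<Sum>i\<in>{1..m}. ?d i * ?z z (m + i) + h (coeff M (m - i)) * ?z z (m - i))"
      unfolding qact_def deg by (rule sum_symmetric_split)
    moreover have "coeff M (m - i) = coeff M (m + i)" if "i \<in> {1..m}" for i
    proof -
      have "2 * m - (m - i) = m + i" "m - i \<le> 2 * m" using that by auto
      then show ?thesis using sym[of "m - i"] by simp
    qed
    ultimately show ?thesis by (simp add: algebra_simps)
  qed
  have "0 = (qact M x + t * ?z x m) * ?z y m - (qact M y + t * ?z y m) * ?z x m"
    using x y by simp
  also have "\<dots> = (\<Sum>i\<in>{1..m}. ?d i * (brk x y (m + i) m + brk x y (m - i) m))"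
    unfolding q by (simp add: brk_def algebra_simps sum_distrib_left sum_distrib_right
        sum.distrib sum_subtractf)
  finally have 0: "(\<Sum>i\<in>{1..m}. ?d i * (brk x y (m + i) m + brk x y (m - i) m)) = 0" by simp
  have tele: "(\<Sum>j<i. brk x y (Suc (m - i + j)) (Suc (m + j)) - brk x y (m - i + j) (m + j))
      = - (brk x y (m + i) m + brk x y (m - i) m)" if "i \<in> {1..m}" for i
    using sum_lessThan_telescope[of "\<lambda>j. brk x y (m - i + j) (m + j)" i] that
    by (simp add: brk_def algebra_simps)
  have "wform M m x y ^ CARD('a) - wform M m x y =
      (\<Sum>i\<in>{1..m}. ?d i * (\<Sum>j<i. brk x y (Suc (m - i + j)) (Suc (m + j)) - brk x y (m - i + j) (m + j)))"
    by (simp add: wform_def frob_sum power_mult_distrib frob_h brk_frob sum_distrib_left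
        sum_subtractf right_diff_distrib)
  also have "\<dots> = (\<Sum>i\<in>{1..m}. - (?d i * (brk x y (m + i) m + brk x y (m - i) m)))"
    by (rule sum.cong) (simp_all only: tele mult_minus_right)
  also have "\<dots> = 0" using 0 by (simp only: sum_negf neg_equal_0_iff_equal)
  finally show ?thesis by simp
qed

text \<open>For fixed \<open>x\<close> the form is a \<open>q\<close>-polynomial in \<open>y\<close>
  with exponents below \<open>q^(2m)\<close>, so vanishing on \<open>A\<close> kills its
  coefficients. The linear one comes only from \<open>i = m\<close>, \<open>j = 0\<close> and equals
  \<open>- x^(q^m)\<close>.\<close>

lemma wform_nondegenerate:
  assumes m: "1 \<le> m" and c: "coeff M (2 * m) = 1" and A: "CARD('a) ^ (2 * m) \<le> card A"
    and 0: "\<And>y. y \<in> A \<Longrightarrow> wform M m x y = 0"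
  shows "x = 0"
proof -
  let ?z = "\<lambda>z k. z ^ (CARD('a) ^ k) :: 'b"
  \<comment> \<open>\<open>D i j k\<close> is the coefficient of \<open>y^(q^k)\<close> in the
    \<open>(i, j)\<close> summand.\<close>
  define D where "D i j k = h (coeff M (m + i)) *
    ((if k = m + j then ?z x (m - i + j) else 0) - (if k = m - i + j then ?z x (m + j) else 0))" for i j k
  define a where "a k = (\<Sum>i\<in>{1..m}. \<Sum>j<i. D i j k)" for k
  have D: "(\<Sum>k<2 * m. D i j k * ?z y k) = h (coeff M (m + i)) * brk x y (m - i + j) (m + j)"
    if "i \<in> {1..m}" "j < i" for i j y
  proof -
    have "m + j < 2 * m" "m - i + j < 2 * m" using that by auto
    moreover have "D i j k * ?z y k =
        (if k = m + j then h (coeff M (m + i)) * ?z x (m - i + j) * ?z y (m + j) else 0) -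
        (if k = m - i + j then h (coeff M (m + i)) * ?z x (m + j) * ?z y (m - i + j) else 0)" for k
      by (simp add: D_def algebra_simps)
    ultimately show ?thesis by (simp add: brk_def sum_subtractf right_diff_distrib mult.assoc)
  qed
  have "(\<Sum>k<2 * m. a k * ?z y k) = wform M m x y" for y
  proof -
    have "(\<Sum>k<2 * m. a k * ?z y k) = (\<Sum>k<2 * m. \<Sum>i\<in>{1..m}. \<Sum>j<i. D i j k * ?z y k)"
      by (simp add: a_def sum_distrib_right)
    also have "\<dots> = (\<Sum>i\<in>{1..m}. \<Sum>k<2 * m. \<Sum>j<i. D i j k * ?z y k)" by (rule sum.swap)
    also have "\<dots> = (\<Sum>i\<in>{1..m}. \<Sum>j<i. \<Sum>k<2 * m. D i j k * ?z y k)"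
      by (rule sum.cong[OF refl]) (rule sum.swap)
    finally show ?thesis using D by (simp add: wform_def)
  qed
  then have "a 0 = 0"
    using m 0 A by (intro linearized_coeff_eq_0[where A=A and n="2 * m" and a=a and 'a='a]) auto
  moreover have "a 0 = - ?z x m"
  proof -
    have "(\<Sum>j<i. D i j 0) = (if i = m then - ?z x m else 0)" if "i \<in> {1..m}" for i
    proof (cases "i = m")
      case True
      have "(\<Sum>j<m. D m j 0) = (\<Sum>j<m. if j = 0 then - ?z x m else 0)"
        by (rule sum.cong) (use c m in \<open>auto simp: D_def mult_2\<close>)
      then show ?thesis using True m by simp
    next
      case False
      then have "D i j 0 = 0" for j using that by (simp add: D_def)
      then show ?thesis using False by simp
    qed
    then have "a 0 = (\<Sum>i\<in>{1..m}. if i = m then - ?z x m else 0)" by (simp add: a_def)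
    then show ?thesis using m by simp
  qed
  ultimately have "?z x m = 0" by simp
  then show ?thesis by simp
qed

end

section \<open>Embedding the splitting field into Laurent series\<close>

lemma fract_hom_extension:
  fixes \<kappa> :: "'r::idom \<Rightarrow> 'f::field"
  assumes hom: "comm_ring_hom \<kappa>" and inj: "\<And>a. \<kappa> a = 0 \<Longrightarrow> a = 0"
  shows "\<exists>\<iota> :: 'r fract \<Rightarrow> 'f. field_hom \<iota> \<and> (\<forall>a. \<iota> (Fract a 1) = \<kappa> a)"
proof -
  interpret comm_ring_hom \<kappa> by (rule hom)
  define rep where "rep x = (SOME ab. snd ab \<noteq> 0 \<and> x = Fract (fst ab) (snd ab))" for x :: "'r fract"
  define \<iota> where "\<iota> x = \<kappa> (fst (rep x)) / \<kappa> (snd (rep x))" for x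
  have key: "\<iota> (Fract a b) = \<kappa> a / \<kappa> b" if b: "b \<noteq> 0" for a b
  proof -
    have r: "snd (rep (Fract a b)) \<noteq> 0 \<and> Fract a b = Fract (fst (rep (Fract a b))) (snd (rep (Fract a b)))"
      unfolding rep_def by (rule someI[where x = "(a, b)"]) (use b in simp)
    obtain c d where cd: "rep (Fract a b) = (c, d)" by (cases "rep (Fract a b)")
    have d: "d \<noteq> 0" "Fract a b = Fract c d" using r cd by auto
    then have "a * d = c * b" using b by (simp add: eq_fract)
    then have "\<kappa> a * \<kappa> d = \<kappa> c * \<kappa> b" by (metis hom_mult)
    moreover have "\<kappa> b \<noteq> 0" "\<kappa> d \<noteq> 0" using inj b d by blast+
    ultimately show ?thesis by (simp add: \<iota>_def cd field_simps)
  qed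
  have nz: "\<kappa> b \<noteq> 0" if "b \<noteq> 0" for b using inj that by blast
  have "field_hom \<iota>"
  proof
    show "\<iota> 0 = 0" "\<iota> 1 = 1" using key[of 1 0] key[of 1 1] by (simp_all add: Zero_fract_def One_fract_def)
    fix x y :: "'r fract"
    obtain a b where x: "x = Fract a b" "b \<noteq> 0" by (cases x)
    obtain c d where y: "y = Fract c d" "d \<noteq> 0" by (cases y)
    show "\<iota> (x + y) = \<iota> x + \<iota> y" using x y nz[of b] nz[of d]
      by (simp add: key hom_add hom_mult add_frac_eq)
    show "\<iota> (x * y) = \<iota> x * \<iota> y" using x y by (simp add: key hom_mult)
  qed
  then show ?thesis using key by (intro exI[of _ \<iota>]) simp
qed

lemma const_ff_0: "const_ff 0 = 0" and const_ff_1: "const_ff 1 = 1"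
  and const_ff_add: "const_ff (a + b) = const_ff a + const_ff b"
  and const_ff_mult: "const_ff (a * b) = const_ff a * const_ff b"
  by (simp_all add: const_ff_def Zero_fract_def One_fract_def pCons_one mult.commute)

lemma field_hom_of_embedding: "field_embedding emb \<Longrightarrow> field_hom emb"
  by unfold_locales (auto simp: field_embedding_def)

lemma is_subfield_range:
  assumes "field_hom g"
  shows "is_subfield (range g)"
proof -
  interpret field_hom g by (rule assms)
  show ?thesis unfolding is_subfield_def
    by (auto simp flip: hom_zero hom_one hom_add hom_mult hom_uminus hom_inverse)
qed

lemma is_subfield_vimage:
  assumes "field_hom g" "is_subfield S"
  shows "is_subfield {z. g z \<in> S}"
proof -
  interpret field_hom g by (rule assms)
  show ?thesis using assms(2) unfolding is_subfield_def
    by (simp add: hom_add hom_mult hom_uminus hom_inverse)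
qed

locale splitting_setting = laurent_roots h M m
  for h :: "'a::{field,finite} \<Rightarrow> 'k::alg_closed_field" and M m +
  fixes emb :: "'a poly fract \<Rightarrow> 'e::field"
  assumes split: "is_splitting_field emb (L_poly m M)"
begin

sublocale emb: field_hom emb
  using split by (intro field_hom_of_embedding) (simp add: is_splitting_field_def)

definition hE :: "'a \<Rightarrow> 'e" where "hE c = emb (const_ff c)"

sublocale E: fq_hom hE
  by unfold_locales (simp_all add: hE_def const_ff_0 const_ff_1 const_ff_add const_ff_mult emb.hom_add emb.hom_mult)

definition V :: "'e set" where "V = roots_in emb (L_poly m M)"

definition L_E :: "'e poly" where
  "L_E = (\<Sum>i\<le>2 * m. monom (hE (coeff M i)) (CARD('a) ^ i)) + monom (emb tvar) (CARD('a) ^ m)"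

lemma map_poly_L: "map_poly emb (L_poly m M) = L_E"
proof (rule poly_eqI)
  fix n
  show "coeff (map_poly emb (L_poly m M)) n = coeff L_E n"
    by (simp add: coeff_map_poly L_poly_def Phi_poly_def L_E_def deg_M coeff_sum hE_def emb.hom_add
        emb.hom_sum if_distrib[of emb] cong: if_cong)
qed

lemma V_iff: "x \<in> V \<longleftrightarrow> E.qact M x + emb tvar * x ^ (CARD('a) ^ m) = 0"
  by (simp add: V_def roots_in_def map_poly_L L_E_def poly_sum poly_monom E.qact_def deg_M)

lemma V_eq_roots: "V = {x. poly L_E x = 0}"
  by (simp add: V_def roots_in_def map_poly_L)

lemma generated: "is_subfield S \<Longrightarrow> range emb \<subseteq> S \<Longrightarrow> V \<subseteq> S \<Longrightarrow> S = UNIV"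
  using split by (auto simp: is_splitting_field_def V_def)

definition \<kappa> :: "'a poly \<Rightarrow> 'k fls" where
  "\<kappa> a = fps_to_fls (fps_of_poly (map_poly h a))"

lemma \<kappa>_hom: "comm_ring_hom \<kappa>"
proof -
  interpret P: map_poly_comm_ring_hom h ..
  show ?thesis
    by unfold_locales
       (simp_all add: \<kappa>_def P.hom_add P.hom_mult fps_of_poly_add fps_of_poly_mult fls_times_fps_to_fls)
qed

lemma \<kappa>_const: "\<kappa> [:c:] = fls_const (h c)"
proof -
  have "map_poly h [:c:] = [:h c:]"
    by (rule poly_eqI) (simp add: coeff_map_poly coeff_pCons split: nat.split)
  then show ?thesis by (simp add: \<kappa>_def fps_of_poly_const)
qed

lemma \<kappa>_X: "\<kappa> [:0, 1:] = fls_X"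
proof -
  have "map_poly h [:0, 1:] = [:0, 1:]"
    by (rule poly_eqI) (simp add: coeff_map_poly coeff_pCons split: nat.split)
  then show ?thesis by (simp add: \<kappa>_def)
qed

lemma \<kappa>_nth: "fls_nth (\<kappa> a) n = (if n < 0 then 0 else h (coeff a (nat n)))"
  by (simp add: \<kappa>_def coeff_map_poly)

text \<open>F_q(t) embeds by t \<mapsto> \<open>fls_X\<close>. Since L has a full set of distinct
  roots in the Laurent series field, this map extends over every root in \<open>V\<close>, and
  \<open>V\<close> generates \<open>'e\<close>.\<close>

lemma ex_embedding:
  "\<exists>f :: 'e \<Rightarrow> 'k fls. field_hom f \<and> (\<forall>a. f (emb (Fract a 1)) = \<kappa> a)"
proof -
  have "a = 0" if 0: "\<kappa> a = 0" for a
  proof (rule poly_eqI)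
    fix n
    show "coeff a n = coeff 0 n" using \<kappa>_nth[of a "int n"] by (simp add: 0)
  qed
  then obtain j :: "'a poly fract \<Rightarrow> 'k fls" where j: "field_hom j" "\<And>a. j (Fract a 1) = \<kappa> a"
    using fract_hom_extension[OF \<kappa>_hom] by blast
  interpret j: field_hom j by (rule j)
  have inje: "inj emb" by (rule emb.inj_f)
  define g where "g z = j (inv_into UNIV emb z)" for z
  have g: "g (emb x) = j x" for x by (simp add: g_def inje)
  have hom: "hom_on (range emb) g" unfolding hom_on_def
  proof (intro conjI ballI)
    show "g 1 = 1" using g[of 1] by simp
    fix x y assume "x \<in> range emb" "y \<in> range emb"
    then obtain a b where [simp]: "x = emb a" "y = emb b" by auto
    show "g (x + y) = g x + g y" using g[of "a + b"] by (simp add: g emb.hom_add j.hom_add)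
    show "g (x * y) = g x * g y" using g[of "a * b"] by (simp add: g emb.hom_mult j.hom_mult)
  qed
  interpret S: subfield_hom "range emb" g
    by unfold_locales (rule is_subfield_range[OF emb.field_hom_axioms], rule hom)
  have co: "coeffs_in (range emb) L_E"
    unfolding coeffs_in_def map_poly_L[symmetric] by (simp add: coeff_map_poly)
  have L0: "map_poly g L_E = L_fls"
  proof (rule poly_eqI)
    fix n
    have "coeff (map_poly g L_E) n = j (coeff (L_poly m M) n)"
      unfolding map_poly_L[symmetric] by (simp add: coeff_map_poly g)
    also have "\<dots> = coeff L_fls n"
      by (simp add: L_poly_def Phi_poly_def L_fls_def deg_M coeff_sum j.hom_add j.hom_sum
          const_ff_def tvar_def j(2) \<kappa>_const \<kappa>_X if_distrib[of j] cong: if_cong)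
    finally show "coeff (map_poly g L_E) n = coeff L_fls n" .
  qed
  have nz: "L_E \<noteq> 0" using L0 L_fls_nz by auto
  have "\<exists>T g'. is_subfield T \<and> hom_on T g' \<and> range emb \<subseteq> T \<and> V \<subseteq> T \<and> (\<forall>x\<in>range emb. g' x = g x)"
  proof (rule extend_hom_roots[OF S.sub hom co nz])
    show "card {x. poly (map_poly g L_E) x = 0} = degree L_E"
      using L_fls_roots(1) S.degree_gmap[OF co] by (simp add: L0)
    show "finite V" unfolding V_eq_roots using nz by (rule poly_roots_finite)
    show "poly L_E r = 0" if "r \<in> V" for r using that by (simp add: V_eq_roots)
  qed
  then obtain T g' where T: "is_subfield T" "hom_on T g'" "range emb \<subseteq> T" "V \<subseteq> T"
    "\<And>x. x \<in> range emb \<Longrightarrow> g' x = g x" by blast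
  have "T = UNIV" using generated T by blast
  then interpret G: subfield_hom UNIV g' by unfold_locales (use T in auto)
  have "field_hom g'" by unfold_locales (auto simp: G.g_0 G.g_1 G.g_add G.g_mult)
  moreover have "g' (emb (Fract a 1)) = \<kappa> a" for a using T(5) by (simp add: g j(2))
  ultimately show ?thesis by blast
qed

end

section \<open>The Frobenius element\<close>

locale frobenius_setting = splitting_setting h M m emb
  for h :: "'a::{field,finite} \<Rightarrow> 'k::alg_closed_field" and M m
    and emb :: "'a poly fract \<Rightarrow> 'e::field" +
  fixes f :: "'e \<Rightarrow> 'k fls"
  assumes f_hom: "field_hom f" and f_emb: "f (emb (Fract a 1)) = \<kappa> a"
begin

sublocale f: field_hom f by (rule f_hom)

sublocale \<phi>: field_hom "fls_frob CARD('a) :: 'k fls \<Rightarrow> 'k fls" by (rule fls_frob_field_hom)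

lemma f_hE: "f (hE c) = fls_const (h c)"
  by (simp add: hE_def const_ff_def f_emb \<kappa>_const)

lemma f_tvar: "f (emb tvar) = fls_X"
  by (simp add: tvar_def f_emb \<kappa>_X)

lemma \<phi>_\<kappa>: "fls_frob CARD('a) (\<kappa> a) = \<kappa> a"
  by (rule fls_eqI) (simp add: fls_frob_nth' \<kappa>_nth frob_zero frob_h)

lemma \<phi>_f_emb: "fls_frob CARD('a) (f (emb x)) = f (emb x)"
proof -
  obtain a b where x: "x = Fract a b" "b \<noteq> 0" by (cases x)
  then have "x * Fract b 1 = Fract a 1" by (simp add: eq_fract)
  then have "f (emb x) * \<kappa> b = \<kappa> a" by (metis emb.hom_mult f.hom_mult f_emb)
  then have e: "fls_frob CARD('a) (f (emb x)) * \<kappa> b = f (emb x) * \<kappa> b" by (metis \<phi>.hom_mult \<phi>_\<kappa>)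
  have "Fract b 1 \<noteq> 0" using x by (simp add: eq_fract Zero_fract_def)
  then have "\<kappa> b \<noteq> 0" using f_emb[of b] emb.hom_0_iff f.hom_0_iff by metis
  then show ?thesis using e by simp
qed

lemma poly_L_fls_f: "poly L_fls (f x) = f (poly L_E x)"
  by (simp add: L_fls_def L_E_def poly_sum poly_monom f.hom_add f.hom_sum f.hom_mult f.hom_power f_hE f_tvar)

lemma poly_L_fls_\<phi>: "poly L_fls (fls_frob CARD('a) x) = fls_frob CARD('a) (poly L_fls x)"
proof -
  have "fls_frob CARD('a) fls_X = (fls_X :: 'k fls)" using \<phi>_f_emb[of tvar] by (simp add: f_tvar)
  then show ?thesis
    by (simp add: L_fls_def poly_sum poly_monom \<phi>.hom_add \<phi>.hom_sum \<phi>.hom_mult \<phi>.hom_power fls_frob_const)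
qed

lemma map_poly_f_L_E: "map_poly f L_E = L_fls"
  by (rule poly_eqI) (simp add: coeff_map_poly L_fls_def L_E_def coeff_sum f.hom_add f.hom_sum f_hE f_tvar
      if_distrib[of f] cong: if_cong)

lemma L_E_nz: "L_E \<noteq> 0"
  using map_poly_f_L_E L_fls_nz by auto

lemma f_V: "f ` V = {x. poly L_fls x = 0}"
proof
  show "f ` V \<subseteq> {x. poly L_fls x = 0}" by (auto simp: poly_L_fls_f V_eq_roots)
  show "{x. poly L_fls x = 0} \<subseteq> f ` V"
  proof
    fix x assume "x \<in> {x. poly L_fls x = 0}"
    then have x: "poly L_fls x = 0" by simp
    obtain c rs where L: "L_E = smult c (\<Prod>r\<leftarrow>rs. [:- r, 1:])"
      using split unfolding is_splitting_field_def map_poly_L by blast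
    have "poly (map_poly f (smult c (\<Prod>r\<leftarrow>rs. [:- r, 1:]))) x = f c * (\<Prod>r\<leftarrow>rs. x - f r)"
    proof -
      interpret P: map_poly_comm_ring_hom f ..
      have "map_poly f [:- r, 1:] = [:- f r, 1:]" for r
        by (rule poly_eqI) (simp add: coeff_map_poly coeff_pCons f.hom_uminus split: nat.split)
      then have "map_poly f (\<Prod>r\<leftarrow>rs. [:- r, 1:]) = (\<Prod>r\<leftarrow>rs. [:- f r, 1:])"
        by (induction rs) (simp_all add: P.hom_mult del: mult_pCons_left)
      moreover have "map_poly f (smult c p) = smult (f c) (map_poly f p)" for p
        by (rule poly_eqI) (simp add: coeff_map_poly f.hom_mult)
      moreover have "poly (\<Prod>r\<leftarrow>rs. [:- f r, 1:]) x = (\<Prod>r\<leftarrow>rs. x - f r)"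
        by (induction rs) (simp_all del: mult_pCons_left)
      ultimately show ?thesis by simp
    qed
    then have "f c * (\<Prod>r\<leftarrow>rs. x - f r) = 0" using x map_poly_f_L_E L by simp
    moreover have "c \<noteq> 0" using L L_E_nz by auto
    ultimately obtain r where r: "r \<in> set rs" "x = f r" by (auto simp: prod_list_zero_iff)
    then have "f (poly L_E r) = 0" using x by (simp flip: poly_L_fls_f)
    then show "x \<in> f ` V" using r by (auto simp: V_eq_roots)
  qed
qed

lemma \<phi>_roots: "fls_frob CARD('a) ` f ` V = f ` V"
proof -
  have "finite (f ` V)" unfolding f_V using L_fls_nz by (rule poly_roots_finite)
  moreover have "fls_frob CARD('a) ` f ` V \<subseteq> f ` V" unfolding f_V by (auto simp: poly_L_fls_\<phi>)
  moreover have "inj_on (fls_frob CARD('a)) (f ` V)" using \<phi>.inj_f by (rule inj_on_subset) simp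
  ultimately show ?thesis by (rule endo_inj_surj)
qed

lemma range_subset_range:
  assumes "field_hom g1" "field_hom g2" "\<And>x. g1 (emb x) = (g2 (emb x) :: 'k fls)" "g1 ` V \<subseteq> g2 ` V"
  shows "range g1 \<subseteq> range g2"
proof -
  have "is_subfield {z. g1 z \<in> range g2}"
    using assms(1) is_subfield_range[OF assms(2)] by (rule is_subfield_vimage)
  then have "{z. g1 z \<in> range g2} = UNIV" by (rule generated) (use assms(3,4) in auto)
  then show ?thesis by auto
qed

lemma range_\<phi>_f: "range (\<lambda>z. fls_frob CARD('a) (f z)) = range f"
proof -
  have hom: "field_hom (\<lambda>z. fls_frob CARD('a) (f z))"
    by unfold_locales (simp_all add: f.hom_add f.hom_mult \<phi>.hom_add \<phi>.hom_mult)
  have im: "(\<lambda>z. fls_frob CARD('a) (f z)) ` V = f ` V" using \<phi>_roots by (simp add: image_image)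
  show ?thesis
    by (intro equalityI range_subset_range hom f_hom) (simp_all add: \<phi>_f_emb im)
qed

definition \<sigma> :: "'e \<Rightarrow> 'e" where "\<sigma> z = inv_into UNIV f (fls_frob CARD('a) (f z))"

lemma f_\<sigma>: "f (\<sigma> z) = fls_frob CARD('a) (f z)"
  unfolding \<sigma>_def by (rule f_inv_into_f) (use range_\<phi>_f in blast)

lemma \<sigma>_gal: "\<sigma> \<in> gal_group emb"
proof -
  have inj: "f x = f y \<longleftrightarrow> x = y" for x y by simp
  have "inj \<sigma>" by (rule injI) (metis f_\<sigma> f.eq_iff \<phi>.eq_iff)
  moreover have "surj \<sigma>"
  proof (rule surjI)
    fix y
    have "f y \<in> range (\<lambda>z. fls_frob CARD('a) (f z))" using range_\<phi>_f by simp
    then show "\<sigma> (SOME z. f y = fls_frob CARD('a) (f z)) = y"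
      by (metis (mono_tags, lifting) f_\<sigma> f.eq_iff imageE someI_ex)
  qed
  moreover have "\<sigma> (x + y) = \<sigma> x + \<sigma> y" for x y
    by (subst inj[symmetric]) (simp add: f_\<sigma> f.hom_add \<phi>.hom_add)
  moreover have "\<sigma> (x * y) = \<sigma> x * \<sigma> y" for x y
    by (subst inj[symmetric]) (simp add: f_\<sigma> f.hom_mult \<phi>.hom_mult)
  moreover have "\<sigma> (emb a) = emb a" for a
    by (subst inj[symmetric]) (simp add: f_\<sigma> \<phi>_f_emb)
  ultimately show ?thesis by (simp add: gal_group_def bij_def)
qed

lemma gal_V:
  assumes "s \<in> gal_group emb"
  shows "s ` V = V"
proof -
  have s: "bij s" "\<And>x y. s (x + y) = s x + s y" "\<And>x y. s (x * y) = s x * s y" "\<And>a. s (emb a) = emb a"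
    using assms by (auto simp: gal_group_def)
  have s0: "s 0 = 0" using s(4)[of 0] by simp
  have s1: "s 1 = 1" using s(4)[of 1] by simp
  have ss: "s (\<Sum>i\<in>A. u i) = (\<Sum>i\<in>A. s (u i))" for A and u :: "nat \<Rightarrow> 'e"
    by (induction A rule: infinite_finite_induct) (auto simp: s0 s(2))
  have sp: "s (a ^ n) = s a ^ n" for a n by (induction n) (auto simp: s1 s(3))
  have "s (poly L_E x) = poly L_E (s x)" for x
    by (simp add: L_E_def poly_sum poly_monom s ss sp hE_def)
  then have "poly L_E (s x) = 0" if "poly L_E x = 0" for x using that s0 by metis
  then have sub: "s ` V \<subseteq> V" by (auto simp: V_eq_roots)
  have "finite V" unfolding V_eq_roots using L_E_nz by (rule poly_roots_finite)
  then show ?thesis using sub s(1) by (intro endo_inj_surj) (auto simp: bij_def intro: inj_on_subset)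
qed

section \<open>The prime over \<open>t\<close>\<close>

sublocale I: base_hom "\<lambda>a. emb (Fract a 1)"
proof
  show "emb (Fract 0 1) = 0" "emb (Fract 1 1) = 1"
    by (simp_all flip: Zero_fract_def One_fract_def)
  fix x y :: "'a poly"
  have "Fract (x + y) 1 = Fract x 1 + Fract y 1" "Fract (x * y) 1 = Fract x 1 * Fract y 1" by simp_all
  then show "emb (Fract (x + y) 1) = emb (Fract x 1) + emb (Fract y 1)"
    "emb (Fract (x * y) 1) = emb (Fract x 1) * emb (Fract y 1)"
    by (simp_all only: emb.hom_add emb.hom_mult)
qed

lemma int_closure_iff: "z \<in> int_closure emb \<longleftrightarrow> I.integral z"
  by (simp add: int_closure_def I.integral_def)

text \<open>\<open>f\<close> carries the integral equation to a monic one with power series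
  coefficients, and power series are integrally closed among Laurent series.\<close>

lemma integral_f_fps:
  assumes "I.integral z"
  shows "f z \<in> range fps_to_fls"
proof -
  obtain p where p: "lead_coeff p = 1" "poly (map_poly (\<lambda>a. emb (Fract a 1)) p) z = 0"
    using assms by (auto simp: I.integral_def)
  let ?P = "map_poly \<kappa> p"
  interpret k: comm_ring_hom \<kappa> by (rule \<kappa>_hom)
  have "f (poly (map_poly (\<lambda>a. emb (Fract a 1)) p) z) = poly ?P (f z)"
  proof (induction p)
    case (pCons a p)
    then show ?case
      by (simp add: map_poly_pCons I.hom_zero k.hom_zero f.hom_add f.hom_mult f_emb)
  qed simp
  then have ev: "poly ?P (f z) = 0" using p by simp
  have "degree ?P = degree p" by (rule degree_map_poly) (use p in auto)
  then have "lead_coeff ?P = 1" using p by (simp add: coeff_map_poly)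
  moreover have "coeff ?P i \<in> range fps_to_fls" for i by (simp add: coeff_map_poly \<kappa>_def)
  ultimately show ?thesis using ev by (rule fls_integral_imp_fps)
qed

text \<open>Additive everywhere, but multiplicative only on elements without a pole. On the integral
  elements it is the residue map, with kernel \<open>J\<close>.\<close>

definition \<rho> :: "'e \<Rightarrow> 'k" where "\<rho> z = fls_nth (f z) 0"

lemma \<rho>_add: "\<rho> (x + y) = \<rho> x + \<rho> y" and \<rho>_diff: "\<rho> (x - y) = \<rho> x - \<rho> y"
  and \<rho>_0: "\<rho> 0 = 0" and \<rho>_1: "\<rho> 1 = 1" and \<rho>_uminus: "\<rho> (- x) = - \<rho> x"
  by (simp_all add: \<rho>_def f.hom_add f.hom_minus f.hom_uminus)

lemma \<rho>_mult:
  assumes "f x \<in> range fps_to_fls" "f y \<in> range fps_to_fls"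
  shows "\<rho> (x * y) = \<rho> x * \<rho> y"
proof -
  obtain u v where "f x = fps_to_fls u" "f y = fps_to_fls v" using assms by auto
  then show ?thesis by (simp add: \<rho>_def f.hom_mult flip: fls_times_fps_to_fls)
qed

lemma \<rho>_integral_mult: "I.integral x \<Longrightarrow> I.integral y \<Longrightarrow> \<rho> (x * y) = \<rho> x * \<rho> y"
  by (intro \<rho>_mult integral_f_fps)

lemma \<rho>_integral_power: "I.integral x \<Longrightarrow> \<rho> (x ^ n) = \<rho> x ^ n"
  by (induction n) (simp_all add: \<rho>_1 \<rho>_integral_mult I.integral_power)

lemma \<rho>_\<sigma>: "\<rho> (\<sigma> z) = \<rho> z ^ CARD('a)"
  by (simp add: \<rho>_def f_\<sigma> fls_frob_nth')

definition J :: "'e set" where "J = {z. I.integral z \<and> \<rho> z = 0}"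

lemma prime_J: "prime_ideal_in (int_closure emb) J"
  unfolding prime_ideal_in_def
proof (intro conjI)
  have "1 \<in> int_closure emb" "1 \<notin> J" by (auto simp: int_closure_iff J_def I.integral_1 \<rho>_1)
  then show "J \<noteq> int_closure emb" by auto
qed (auto simp: J_def int_closure_iff I.integral_0 \<rho>_0 \<rho>_add \<rho>_uminus \<rho>_integral_mult
    intro: I.integral_add I.integral_uminus I.integral_mult)

lemma lies_over_J: "lies_over emb J 0"
proof -
  have "emb (Fract a 1) \<in> J \<longleftrightarrow> [:- 0, 1:] dvd a" for a
  proof -
    have "emb (Fract a 1) \<in> J \<longleftrightarrow> coeff a 0 = 0"
      using I.integral_base[of a] by (simp add: J_def \<rho>_def f_emb \<kappa>_nth)
    then show ?thesis using poly_eq_0_iff_dvd[of a 0] by (simp add: poly_0_coeff_0)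
  qed
  then show ?thesis by (simp add: lies_over_def)
qed

lemma gal_integral:
  assumes s: "\<And>x y. s (x + y) = s x + s y" "\<And>x y. s (x * y) = s x * s y" "\<And>a. s (emb a) = emb a"
    and z: "I.integral z"
  shows "I.integral (s z)"
proof -
  obtain p where p: "lead_coeff p = 1" "poly (map_poly (\<lambda>a. emb (Fract a 1)) p) z = 0"
    using z by (auto simp: I.integral_def)
  have s0: "s 0 = 0" using s(3)[of 0] by simp
  have "s (poly (map_poly (\<lambda>a. emb (Fract a 1)) p) z) = poly (map_poly (\<lambda>a. emb (Fract a 1)) p) (s z)"
  proof (induction p)
    case (pCons a p)
    then show ?case by (simp add: map_poly_pCons I.hom_zero s)
  qed (simp add: s0)
  then show ?thesis using p s0 unfolding I.integral_def by metis
qed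

lemma \<sigma>_hom: "\<sigma> (x + y) = \<sigma> x + \<sigma> y" "\<sigma> (x * y) = \<sigma> x * \<sigma> y" "\<sigma> (emb a) = emb a" "bij \<sigma>"
  using \<sigma>_gal by (auto simp: gal_group_def)

lemma frobenius_\<sigma>: "frobenius_at emb J \<sigma>"
  unfolding frobenius_at_def
proof (intro conjI ballI)
  show "\<sigma> \<in> gal_group emb" by (rule \<sigma>_gal)
  have int: "I.integral (\<sigma> z)" if "I.integral z" for z
    by (rule gal_integral[OF \<sigma>_hom(1,2,3) that])
  show "\<sigma> ` J = J"
  proof
    show "\<sigma> ` J \<subseteq> J" by (auto simp: J_def int \<rho>_\<sigma> frob_zero)
    show "J \<subseteq> \<sigma> ` J"
    proof
      fix z assume z: "z \<in> J"
      let ?s = "inv_into UNIV \<sigma>"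
      have \<sigma>s: "\<sigma> (?s x) = x" for x using \<sigma>_hom(4) by (simp add: bij_def surj_f_inv_f)
      have eqI: "x = y" if "\<sigma> x = \<sigma> y" for x y using \<sigma>_hom(4) that by (auto simp: bij_def dest: injD)
      have "I.integral (?s z)"
      proof (rule gal_integral[of ?s])
        show "?s (x + y) = ?s x + ?s y" for x y by (rule eqI) (simp add: \<sigma>s \<sigma>_hom(1))
        show "?s (x * y) = ?s x * ?s y" for x y by (rule eqI) (simp add: \<sigma>s \<sigma>_hom(2))
        show "?s (emb a) = emb a" for a by (rule eqI) (simp add: \<sigma>s \<sigma>_hom(3))
        show "I.integral z" using z by (simp add: J_def)
      qed
      moreover have "\<rho> (?s z) ^ CARD('a) = 0" using \<rho>_\<sigma>[of "?s z"] z by (simp add: \<sigma>s J_def)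
      then have "\<rho> (?s z) = 0" by simp
      ultimately have "?s z \<in> J" by (simp add: J_def)
      then show "z \<in> \<sigma> ` J" using \<sigma>s[of z] by (metis imageI)
    qed
  qed
  fix z assume "z \<in> int_closure emb"
  then have "I.integral z" by (simp add: int_closure_iff)
  then show "\<sigma> z - z ^ CARD('a) \<in> J"
    by (simp add: J_def int I.integral_diff I.integral_power \<rho>_diff \<rho>_\<sigma> \<rho>_integral_power)
qed

end

section \<open>The transvection\<close>

context frobenius_setting
begin

text \<open>Injectivity lets identities in \<open>V\<close> be checked on constant terms;
  surjectivity lets roots of \<Phi> be lifted to \<open>V\<close>.\<close>

lemma bij_\<rho>: "bij_betw \<rho> V redroots"
proof -
  have "bij_betw f V {x. poly L_fls x = 0}"
    using f_V by (intro bij_betw_imageI) (auto intro: inj_on_subset[OF f.inj_f])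
  from bij_betw_trans[OF this L_fls_roots(2)] show ?thesis
    by (simp add: \<rho>_def[abs_def] comp_def)
qed

lemma ex_lift: "a \<in> redroots \<Longrightarrow> \<exists>x\<in>V. \<rho> x = a"
  using bij_\<rho> unfolding bij_betw_def by (metis imageE)

lemma \<rho>_eqD: "x \<in> V \<Longrightarrow> y \<in> V \<Longrightarrow> \<rho> x = \<rho> y \<Longrightarrow> x = y"
  using bij_\<rho> by (auto simp: bij_betw_def inj_on_def)

lemma card_V: "card V = CARD('a) ^ (2 * m)"
  using bij_betw_same_card[OF bij_\<rho>] by (simp add: card_redroots)

lemma \<rho>_scal: "\<rho> (scal emb c x) = h c * \<rho> x"
proof -
  have "fls_nth (fls_const (h c) * f x) 0 = h c * fls_nth (f x) 0" by simp
  then show ?thesis by (simp add: \<rho>_def scal_def f.hom_mult f_hE flip: hE_def)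
qed

lemma V_add: "x \<in> V \<Longrightarrow> y \<in> V \<Longrightarrow> x + y \<in> V"
proof -
  assume x: "x \<in> V" and y: "y \<in> V"
  have "E.qact M (x + y) + emb tvar * (x + y) ^ (CARD('a) ^ m)
    = (E.qact M x + emb tvar * x ^ (CARD('a) ^ m)) + (E.qact M y + emb tvar * y ^ (CARD('a) ^ m))"
    by (simp add: E.qact_add_right E.frob_pow_add algebra_simps)
  then show ?thesis using x y by (simp add: V_iff)
qed

lemma V_scal: "x \<in> V \<Longrightarrow> scal emb c x \<in> V"
proof -
  assume x: "x \<in> V"
  have "E.qact M (hE c * x) + emb tvar * (hE c * x) ^ (CARD('a) ^ m)
    = hE c * (E.qact M x + emb tvar * x ^ (CARD('a) ^ m))"
    by (simp only: E.qact_scale_right power_mult_distrib E.frob_pow_h) (simp add: algebra_simps)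
  then show ?thesis using x by (simp add: V_iff scal_def flip: hE_def)
qed

lemma V_diff: "x \<in> V \<Longrightarrow> y \<in> V \<Longrightarrow> x - y \<in> V"
proof -
  assume x: "x \<in> V" and y: "y \<in> V"
  have "scal emb (-1) y = - y"
    using E.hom_uminus[of 1] by (simp add: scal_def flip: hE_def)
  then show ?thesis using V_add[OF x V_scal[OF y, of "-1"]] by simp
qed

lemma \<sigma>_pow_V: "(\<sigma> ^^ n) ` V = V"
proof (induction n)
  case (Suc n)
  then show ?case using gal_V[OF \<sigma>_gal] by (simp only: funpow.simps image_comp[symmetric])
qed simp

lemma \<rho>_\<sigma>_pow: "\<rho> ((\<sigma> ^^ n) x) = \<rho> x ^ (CARD('a) ^ n)"
  by (induction n) (simp_all add: \<rho>_\<sigma> mult.commute[of "CARD('a)"] flip: power_mult)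

lemma \<rho>_\<sigma>_pow_diff: "\<rho> ((\<sigma> ^^ n) x - x) = qact (monom 1 n - 1) (\<rho> x)"
  using qact_monom[of 0] by (simp add: \<rho>_diff \<rho>_\<sigma>_pow qact_diff qact_monom)

lemma ex_form:
  assumes sym: "\<And>i. i \<le> 2 * m \<Longrightarrow> coeff M i = coeff M (2 * m - i)"
  shows "\<exists>B. inv_symplectic_form emb V (gal_group emb) B"
proof -
  define W where "W = E.wform M m"
  \<comment> \<open>The preimage is meaningful only where \<open>W\<close> takes values in
    \<open>range hE\<close>, which \<open>hB\<close> secures for arguments in
    \<open>V\<close>.\<close>
  define B where "B x y = inv_into UNIV hE (W x y)" for x y
  have hB: "hE (B x y) = W x y" if "x \<in> V" "y \<in> V" for x y
  proof -
    have "W x y ^ CARD('a) = W x y" unfolding W_def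
      using deg_M sym by (rule E.wform_frob) (use that in \<open>simp_all add: V_iff\<close>)
    then have "W x y \<in> range hE" by (rule E.frob_fixed_imp_h)
    then show ?thesis unfolding B_def by (rule f_inv_into_f)
  qed
  have eqI: "a = b" if "hE a = hE b" for a b using that by simp
  have "inv_symplectic_form emb V (gal_group emb) B" unfolding inv_symplectic_form_def
  proof (intro conjI ballI allI impI)
    fix x y z assume V: "x \<in> V" "y \<in> V" "z \<in> V"
    show "B (x + y) z = B x z + B y z"
      by (rule eqI) (simp add: hB V V_add E.hom_add, simp add: W_def E.wform_add_left)
    show "B z (x + y) = B z x + B z y"
      by (rule eqI) (simp add: hB V V_add E.hom_add, simp add: W_def E.wform_add_right)
  next
    fix c x y assume V: "x \<in> V" "y \<in> V"
    have sc: "scal emb c z = hE c * z" for z by (simp add: scal_def hE_def)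
    have V': "hE c * z \<in> V" if "z \<in> V" for z using V_scal[OF that, of c] by (simp add: sc)
    show "B (scal emb c x) y = c * B x y" unfolding sc
      by (rule eqI) (simp add: hB V V' E.hom_mult, simp add: W_def E.wform_scale_left)
    show "B x (scal emb c y) = c * B x y" unfolding sc
      by (rule eqI) (simp add: hB V V' E.hom_mult, simp add: W_def E.wform_scale_right)
  next
    fix x assume "x \<in> V"
    then show "B x x = 0" by (intro eqI) (simp add: hB, simp add: W_def E.wform_self)
  next
    fix x assume x: "x \<in> V" and 0: "\<forall>y\<in>V. B x y = 0"
    have W0: "E.wform M m x y = 0" if "y \<in> V" for y
      using hB[OF x that] 0 that by (simp add: W_def)
    have "coeff M (2 * m) = 1" using sym[of 0] M_0 by simp
    then show "x = 0"
      by (rule E.wform_nondegenerate[OF m, of M V x]) (simp_all add: card_V W0)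
  next
    fix s x y assume s: "s \<in> gal_group emb" and V: "x \<in> V" "y \<in> V"
    have sV: "s x \<in> V" "s y \<in> V" using gal_V[OF s] V by blast+
    have "s (W x y) = W (s x) (s y)" unfolding W_def
      by (rule E.wform_hom) (use s in \<open>auto simp: gal_group_def hE_def\<close>)
    moreover have "s (hE (B x y)) = hE (B x y)" using s by (simp add: gal_group_def hE_def)
    ultimately show "B (s x) (s y) = B x y" by (intro eqI) (simp add: hB V sV)
  qed
  then show ?thesis by blast
qed

lemma gal_funpow: "s \<in> gal_group emb \<Longrightarrow> s ^^ n \<in> gal_group emb"
proof (induction n)
  case 0
  show ?case by (simp add: gal_group_def bij_id[unfolded id_def])
next
  case (Suc n)
  have "bij (s ^^ Suc n)" using Suc.prems by (simp only: gal_group_def mem_Collect_eq bij_fn)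
  then show ?case using Suc by (simp add: gal_group_def comp_def)
qed

text \<open>By \<open>n(1)\<close> the constant term of each \<open>\<tau> x - x\<close> is fixed by
  the Frobenius, hence lies in F_q. So the image of \<open>\<tau> - 1\<close> lies in one line,
  which \<open>\<sigma>\<close> and therefore \<open>\<tau>\<close> fix pointwise; this gives the
  square zero. Nontriviality is \<open>n(2)\<close>.\<close>

lemma ex_transvection:
  assumes n: "M dvd [:-1, 1:] * (monom 1 n - 1)" "\<not> M dvd monom 1 n - 1"
    and M1: "poly M 1 = 0"
    and B: "inv_symplectic_form emb V (gal_group emb) B"
  shows "symplectic_transvection emb V B (\<sigma> ^^ n)"
proof -
  let ?\<tau> = "\<sigma> ^^ n" and ?T = "monom 1 n - 1 :: 'a poly"
  have red: "\<rho> x \<in> redroots" if "x \<in> V" for x using bij_\<rho> that by (auto simp: bij_betw_def)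
  have \<tau>V: "?\<tau> x \<in> V" if "x \<in> V" for x using \<sigma>_pow_V[of n] that by blast
  have dV: "?\<tau> x - x \<in> V" if "x \<in> V" for x using V_diff \<tau>V that by blast
  have fix1: "\<rho> (?\<tau> x - x) ^ CARD('a) = \<rho> (?\<tau> x - x)" if x: "x \<in> V" for x
  proof -
    have "qact M (\<rho> x) = 0" using red[OF x] by (simp add: redroots_def)
    then have "qact ([:-1, 1:] * ?T) (\<rho> x) = 0" by (rule qact_eq_0_if_dvd[OF n(1)])
    then have "qact [:-1, 1:] (\<rho> (?\<tau> x - x)) = 0"
      unfolding qact_mult \<rho>_\<sigma>_pow_diff .
    then show ?thesis by (simp add: qact_pCons hom_uminus frob_zero)
  qed
  \<comment> \<open>All powers of 1 agree, so \<Phi>(1) is \<open>M(1)\<close>. The lift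
    \<open>v\<close> of 1 will span the image of \<open>\<tau> - 1\<close>.\<close>
  have "1 \<in> redroots"
  proof -
    have "qact M 1 = h (poly M 1)"
      by (simp add: qact_def poly_altdef hom_sum)
    then show ?thesis using M1 by (simp add: redroots_def)
  qed
  then obtain v where v: "v \<in> V" "\<rho> v = 1" using ex_lift by blast
  show ?thesis unfolding symplectic_transvection_def
  proof (intro conjI ballI)
    show "?\<tau> ` V = V" by (rule \<sigma>_pow_V)
    show "B (?\<tau> x) (?\<tau> y) = B x y" if "x \<in> V" "y \<in> V" for x y
      using B gal_funpow[OF \<sigma>_gal] that unfolding inv_symplectic_form_def by blast
    show "\<exists>x\<in>V. ?\<tau> x \<noteq> x"
    proof (rule ccontr)
      assume "\<not> (\<exists>x\<in>V. ?\<tau> x \<noteq> x)"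
      then have triv: "qact ?T (\<rho> x) = 0" if "x \<in> V" for x
        using that by (simp add: \<rho>_0 flip: \<rho>_\<sigma>_pow_diff)
      \<comment> \<open>On the roots of \<Phi>, \<open>X^n - 1\<close> acts as its remainder modulo
        \<open>M\<close>. This is nonzero of degree below \<open>2 * m\<close>, too small to kill
        \<open>q^(2m)\<close> roots.\<close>
      define R where "R = ?T mod M"
      have R: "R \<noteq> 0" using n(2) by (simp add: R_def mod_eq_0_iff_dvd)
      have degR: "degree R < 2 * m"
        using R degree_mod_less[OF M_nz, of ?T] deg_M by (auto simp: R_def)
      have "coeff R k = 0" if "k < 2 * m" for k
      proof -
        have "h (coeff R k) = 0"
        proof (rule linearized_coeff_eq_0[where A = redroots and n = "2 * m" and 'a = 'a])
          fix a assume a: "a \<in> redroots"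
          then obtain x where x: "x \<in> V" "\<rho> x = a" using ex_lift by blast
          have "?T = (?T div M) * M + R" by (simp add: R_def)
          then have "qact ?T a = qact (?T div M) (qact M a) + qact R a"
            by (metis qact_add qact_mult)
          then have "qact R a = 0" using triv[OF x(1)] x(2) a by (simp add: redroots_def)
          moreover have "qact R a = (\<Sum>i\<le>2 * m - 1. h (coeff R i) * a ^ (CARD('a) ^ i))"
            using degR by (intro qact_eq_sum) auto
          moreover have "{..2 * m - 1} = {..<2 * m}" using m by auto
          ultimately show "(\<Sum>i<2 * m. h (coeff R i) * a ^ (CARD('a) ^ i)) = 0" by simp
        qed (use that in \<open>simp_all add: card_redroots\<close>)
        then show ?thesis by simp
      qed
      then have "lead_coeff R = 0" using degR by blast
      then show False using R by simp
    qed
  next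
    fix x assume x: "x \<in> V"
    let ?w = "?\<tau> x - x"
    have "\<rho> (\<sigma> ?w) = \<rho> ?w" using fix1[OF x] by (simp add: \<rho>_\<sigma>)
    then have "\<sigma> ?w = ?w" using gal_V[OF \<sigma>_gal] dV[OF x] by (intro \<rho>_eqD) blast+
    then have "(\<sigma> ^^ k) ?w = ?w" for k by (induction k) simp_all
    then show "?\<tau> ?w - ?w = 0" by simp
  next
    show "\<exists>v\<in>V. v \<noteq> 0 \<and> (\<forall>x\<in>V. \<exists>c. ?\<tau> x - x = scal emb c v)"
    proof (intro bexI conjI ballI)
      show "v \<in> V" by (rule v)
      show "v \<noteq> 0" using v \<rho>_0 by auto
      fix x assume x: "x \<in> V"
      obtain c where "\<rho> (?\<tau> x - x) = h c" using frob_fixed_imp_h[OF fix1[OF x]] by auto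
      then have "\<rho> (?\<tau> x - x) = \<rho> (scal emb c v)" by (simp add: \<rho>_scal v)
      then have "?\<tau> x - x = scal emb c v" using dV[OF x] V_scal[OF v(1)] by (intro \<rho>_eqD)
      then show "\<exists>c. ?\<tau> x - x = scal emb c v" by blast
    qed
  qed
qed

end

section \<open>The theorem, with k the algebraic closure of F_q\<close>

theorem theorem3p5:
  fixes M :: "'a::{field,finite} poly"
    and m :: nat
    and emb :: "'a poly fract \<Rightarrow> 'e::field"
  assumes "m \<ge> 1"
    and "degree M = 2 * m"
    and "self_reciprocal M"
    and "coeff M 0 = 1"
    and "order 1 M = 2"
    and "\<not> [:-1, 1:] dvd (M div [:-1, 1:] ^ 2)"
    and "\<not> [:1, 1:] dvd (M div [:-1, 1:] ^ 2)"
    and "squarefree (M div [:-1, 1:] ^ 2)"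
    and "is_splitting_field emb (L_poly m M)"
  shows "\<exists>B. inv_symplectic_form emb (roots_in emb (L_poly m M)) (gal_group emb) B \<and>
           (\<exists>\<mu> :: 'a. \<exists>J \<sigma> k.
              prime_ideal_in (int_closure emb) J \<and> lies_over emb J \<mu> \<and>
              frobenius_at emb J \<sigma> \<and>
              symplectic_transvection emb (roots_in emb (L_poly m M)) B (\<sigma> ^^ k))"
proof -
  interpret splitting_setting "to_ac :: 'a \<Rightarrow> 'a alg_closure" M m emb
    by unfold_locales (use assms in simp_all)
  obtain f :: "'e \<Rightarrow> 'a alg_closure fls" where f: "field_hom f" "\<And>a. f (emb (Fract a 1)) = \<kappa> a"
    using ex_embedding by blast
  interpret frobenius_setting "to_ac :: 'a \<Rightarrow> 'a alg_closure" M m emb f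
    by (intro frobenius_setting.intro splitting_setting_axioms frobenius_setting_axioms.intro f)
  have sym: "coeff M i = coeff M (2 * m - i)" if "i \<le> 2 * m" for i
  proof -
    have "M = reflect_poly M" using assms(3,4) by (simp add: self_reciprocal_def)
    then have "coeff M i = coeff (reflect_poly M) i" by simp
    then show ?thesis using that assms(2) by (simp add: coeff_reflect_poly)
  qed
  obtain B where B: "inv_symplectic_form emb V (gal_group emb) B" using ex_form[OF sym] by blast
  define M1 where "M1 = M div [:-1, 1:] ^ 2"
  have M_eq: "M = [:-1, 1:] ^ 2 * M1"
  proof -
    have "[:-1, 1:] ^ 2 dvd M" using order_1[of 1 M] assms(5) by simp
    then show ?thesis by (simp only: M1_def dvd_mult_div_cancel)
  qed
  have M1_1: "poly M1 1 \<noteq> 0" using assms(6) by (simp add: M1_def poly_eq_0_iff_dvd)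
  have "poly M 0 = poly M1 0" by (subst M_eq) (simp add: poly_power)
  then have "coeff M1 0 \<noteq> 0" using assms(4) by (simp add: poly_0_coeff_0)
  then obtain n where n: "M dvd [:-1, 1:] * (monom 1 n - 1)" "\<not> M dvd monom 1 n - 1"
    using transvection_exponent[of M1] assms(8) M1_1 M1_def M_eq by metis
  have "poly M 1 = 0" by (subst M_eq) (simp add: poly_power)
  then have "symplectic_transvection emb V B (\<sigma> ^^ n)" using n B by (intro ex_transvection)
  \<comment> \<open>The witnesses are \<mu> = 0, from \<open>lies_over_J\<close>, and the exponent
    \<open>n\<close>.\<close>
  then show ?thesis
    using B prime_J lies_over_J frobenius_\<sigma> unfolding V_def by blast
qed

end
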